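(* Let $S$ be a separable and complete metric space. QID random measures are dense in the space of independently scattered random measures, considered as random elements in $\hat{\mathcal{M}}_S$ endowed with the vague topology or with the weak topology, under convergence in distribution; that is, for every independently scattered a.s. bounded random measure $\xi$ on $S$ and for each of the two topologies on $\hat{\mathcal{M}}_S$ there is a sequence $(\xi_n)$ of a.s. bounded QID random measures on $S$ converging in distribution to $\xi$ as random elements of $\hat{\mathcal{M}}_S$ with that topology.
   Context: Here all (random) measures are non-negative. $\mathbf{S}$ is the Borel $\sigma$-algebra of $S$. $\hat{\mathcal{M}}_S$ is the space of bounded (finite) measures on $S$. The vague topology is the coarsest one making $\mu\mapsto\int f\,d\mu$ continuous for every bounded continuous $f:S\to\mathbb{R}_+$ with bounded support; the weak topology is the coarsest one making these maps continuous for all bounded continuous $f$. An a.s. bounded random measure is a random element of $\hat{\mathcal{M}}_S$. Convergence in distribution $\xi_n\to\xi$ with respect to a topology means $\mathbb{E}[g(\xi_n)]\to\mathbb{E}[g(\xi)]$ for every bounded continuous $g:\hat{\mathcal{M}}_S\to\mathbb{R}$ for that topology. A random measure $\xi$ is independently scattered if $\xi(B_1),\xi(B_2),\dots$ are independent for disjoint $B_1,B_2,\dots\in\mathbf{S}$. It is a QID random measure if it is independently scattered and $\xi(B)$ is a QID random variable for every $B\in\mathbf{S}$. A real random variable is QID (quasi-infinitely divisible) if its characteristic function is $\exp(i\theta\gamma-\frac{\theta^2}{2}a+\int_{\mathbb{R}}(e^{i\theta x}-1-i\theta\tau(x))\nu(dx))$ with $a,\gamma\in\mathbb{R}$, $\tau(x)=x$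 for $|x|\le1$, $\tau(x)=x/|x|$ for $|x|>1$, and $\nu$ a quasi-Lévy type measure: a real-valued function on the Borel sets $B$ with $0\notin\overline B$, whose restriction to Borel sets disjoint from $(-r,r)$ is a finite signed measure for every $r>0$ and with $\int(1\wedge x^2)|\nu|(dx)<\infty$, where $\nu^+,\nu^-,|\nu|$ are the measures on $\mathcal{B}(\mathbb{R})$ with no mass at $0$ induced by the positive parts, negative parts and total variations of the restrictions, and $\int g\,d\nu=\int g\,d\nu^+-\int g\,d\nu^-$. *)

theory Defs
  imports "HOL-Probability.Probability"
begin

section \<open>Random measures with finite total mass\<close>

definition finite_measures :: "'a::topological_space measure set" where
  "finite_measures = {\<mu>. sets \<mu> = sets borel \<and> finite_measure \<mu>}"

definition finite_measure_algebra :: "'a::topological_space measure measure" where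
  "finite_measure_algebra =
     sigma finite_measures
       {{\<mu> \<in> finite_measures. emeasure \<mu> B \<in> U} | B U. B \<in> sets borel \<and> U \<in> sets borel}"

definition bounded_random_measure ::
    "'w measure \<Rightarrow> ('w \<Rightarrow> 'a::topological_space measure) \<Rightarrow> bool" where
  "bounded_random_measure M \<xi> \<longleftrightarrow> prob_space M \<and> \<xi> \<in> M \<rightarrow>\<^sub>M finite_measure_algebra"

definition independently_scattered ::
    "'w measure \<Rightarrow> ('w \<Rightarrow> 'a::topological_space measure) \<Rightarrow> bool" where
  "independently_scattered M \<xi> \<longleftrightarrow>
     (\<forall>B :: nat \<Rightarrow> 'a set. range B \<subseteq> sets borel \<and> disjoint_family B \<longrightarrow>
        prob_space.indep_vars M (\<lambda>_. borel) (\<lambda>i \<omega>. measure (\<xi> \<omega>) (B i)) UNIV)"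


section \<open>Vague and weak topology, convergence in distribution\<close>

text \<open>The coarsest topology on the finite measures that makes integration of every
  member of \<open>F\<close> continuous.\<close>

definition integral_topology :: "('a::topological_space \<Rightarrow> real) set \<Rightarrow> 'a measure topology" where
  "integral_topology F =
     topology_generated_by
       (insert finite_measures
         {{\<mu> \<in> finite_measures. (\<integral>x. f x \<partial>\<mu>) \<in> U} | f U. f \<in> F \<and> open U})"

definition weak_topology :: "'a::topological_space measure topology" where
  "weak_topology =
     integral_topology {f. continuous_on UNIV f \<and> bounded (range f) \<and> (\<forall>x. 0 \<le> f x)}"

definition vague_topology :: "'a::metric_space measure topology" where
  "vague_topology =
     integral_topology {f. continuous_on UNIV f \<and> bounded (range f) \<and> (\<forall>x. 0 \<le> f x) \<and>
                           bounded (closure {x. f x \<noteq> 0})}"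

text \<open>The random elements may live on different probability spaces. The Bochner integral of
  a non-integrable function is 0 by convention; the integrability conditions only ensure
  that the expectations below are genuine ones.\<close>

definition converges_in_distribution ::
    "'b topology \<Rightarrow> (nat \<Rightarrow> 'v measure) \<Rightarrow> (nat \<Rightarrow> 'v \<Rightarrow> 'b) \<Rightarrow> 'w measure \<Rightarrow> ('w \<Rightarrow> 'b) \<Rightarrow> bool" where
  "converges_in_distribution T N X M Y \<longleftrightarrow>
     (\<forall>g :: 'b \<Rightarrow> real. continuous_map T euclideanreal g \<and> bounded (g ` topspace T) \<longrightarrow>
        (\<forall>n. integrable (N n) (\<lambda>\<omega>. g (X n \<omega>))) \<and>
        integrable M (\<lambda>\<omega>. g (Y \<omega>)) \<and>
        (\<lambda>n. \<integral>\<omega>. g (X n \<omega>) \<partial>N n) \<longlonglongrightarrow> (\<integral>\<omega>. g (Y \<omega>) \<partial>M))"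


section \<open>Signed measures and their variations\<close>

definition finite_signed_measure :: "'a measure \<Rightarrow> ('a set \<Rightarrow> real) \<Rightarrow> bool" where
  "finite_signed_measure M \<nu> \<longleftrightarrow>
     \<nu> {} = 0 \<and>
     (\<forall>A :: nat \<Rightarrow> 'a set. range A \<subseteq> sets M \<and> disjoint_family A \<longrightarrow>
        (\<lambda>i. \<nu> (A i)) sums \<nu> (\<Union>i. A i))"

definition pos_variation :: "'a measure \<Rightarrow> ('a set \<Rightarrow> real) \<Rightarrow> 'a set \<Rightarrow> ennreal" where
  "pos_variation M \<nu> A = (SUP B\<in>{B \<in> sets M. B \<subseteq> A}. ennreal (\<nu> B))"

definition neg_variation :: "'a measure \<Rightarrow> ('a set \<Rightarrow> real) \<Rightarrow> 'a set \<Rightarrow> ennreal" where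
  "neg_variation M \<nu> A = (SUP B\<in>{B \<in> sets M. B \<subseteq> A}. ennreal (- \<nu> B))"

definition total_variation :: "'a measure \<Rightarrow> ('a set \<Rightarrow> real) \<Rightarrow> 'a set \<Rightarrow> ennreal" where
  "total_variation M \<nu> A =
     (SUP P\<in>{P. finite P \<and> P \<subseteq> sets M \<and> disjoint P \<and> \<Union>P = A}. \<Sum>B\<in>P. ennreal \<bar>\<nu> B\<bar>)"


section \<open>Quasi-Levy type measures\<close>

text \<open>A quasi-Levy type measure is a function of the Borel sets whose closure does not
  contain 0. It is represented by a function on all sets of reals; the values at other sets
  are never used.\<close>

definition off_zero :: "real \<Rightarrow> real measure" where
  "off_zero r = restrict_space borel (- {-r<..<r})"

text \<open>The measure on the Borel sets of the line, without mass at 0, that is induced by a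
  consistent family of measures \<open>m r\<close> on the complements of \<open>(-r, r)\<close>.\<close>

definition induced_measure :: "(real \<Rightarrow> real set \<Rightarrow> ennreal) \<Rightarrow> real measure" where
  "induced_measure m =
     measure_of UNIV (sets borel) (\<lambda>A. SUP r\<in>{0<..}. m r (A - {-r<..<r}))"

definition ql_pos :: "(real set \<Rightarrow> real) \<Rightarrow> real measure" where
  "ql_pos \<nu> = induced_measure (\<lambda>r. pos_variation (off_zero r) \<nu>)"

definition ql_neg :: "(real set \<Rightarrow> real) \<Rightarrow> real measure" where
  "ql_neg \<nu> = induced_measure (\<lambda>r. neg_variation (off_zero r) \<nu>)"

definition ql_abs :: "(real set \<Rightarrow> real) \<Rightarrow> real measure" where
  "ql_abs \<nu> = induced_measure (\<lambda>r. total_variation (off_zero r) \<nu>)"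

definition quasi_levy_type :: "(real set \<Rightarrow> real) \<Rightarrow> bool" where
  "quasi_levy_type \<nu> \<longleftrightarrow>
     (\<forall>r>0. finite_signed_measure (off_zero r) \<nu>) \<and>
     (\<integral>\<^sup>+x. ennreal (min 1 (x\<^sup>2)) \<partial>ql_abs \<nu>) < \<infinity>"

definition ql_integral :: "(real set \<Rightarrow> real) \<Rightarrow> (real \<Rightarrow> complex) \<Rightarrow> complex" where
  "ql_integral \<nu> g = (\<integral>x. g x \<partial>ql_pos \<nu>) - (\<integral>x. g x \<partial>ql_neg \<nu>)"


section \<open>Quasi-infinitely divisible random variables and random measures\<close>

definition centering :: "real \<Rightarrow> real" where
  "centering x = (if \<bar>x\<bar> \<le> 1 then x else x / \<bar>x\<bar>)"

definition qid_exponent :: "real \<Rightarrow> real \<Rightarrow> (real set \<Rightarrow> real) \<Rightarrow> real \<Rightarrow> complex" where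
  "qid_exponent \<gamma> a \<nu> \<theta> =
     \<i> * of_real (\<theta> * \<gamma>) - of_real (\<theta>\<^sup>2 / 2 * a)
       + ql_integral \<nu> (\<lambda>x. exp (\<i> * of_real (\<theta> * x)) - 1 - \<i> * of_real (\<theta> * centering x))"

definition qid_random_variable :: "'w measure \<Rightarrow> ('w \<Rightarrow> real) \<Rightarrow> bool" where
  "qid_random_variable M X \<longleftrightarrow>
     X \<in> borel_measurable M \<and>
     (\<exists>\<gamma> a \<nu>. quasi_levy_type \<nu> \<and>
        (\<forall>\<theta>. char (distr M borel X) \<theta> = exp (qid_exponent \<gamma> a \<nu> \<theta>)))"

definition qid_random_measure ::
    "'w measure \<Rightarrow> ('w \<Rightarrow> 'a::topological_space measure) \<Rightarrow> bool" where
  "qid_random_measure M \<xi> \<longleftrightarrow>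
     independently_scattered M \<xi> \<and>
     (\<forall>B\<in>sets borel. qid_random_variable M (\<lambda>\<omega>. measure (\<xi> \<omega>) B))"

end

theory Submission
  imports Defs "HOL-Computational_Algebra.Fundamental_Theorem_Algebra"
begin

text \<open>
  Every independently scattered \<open>\<xi>\<close> is a limit, at each single \<open>\<omega>\<close>, of random measures with
  finitely many deterministic atoms and independent lattice valued masses, and the joint law of
  finitely many such masses can be changed slightly so that the masses become QID.

  \<^item> Discretisation. Fix a dense sequence \<open>d\<close>. Sending \<open>x\<close> to the nearest of \<open>d 0, ..., d n\<close> cuts
    the space into finitely many cells. Put the mass of \<open>\<xi>\<close> in the cell of \<open>d i\<close>, rounded down to
    a multiple of \<open>1/(n+1)^2\<close> and truncated at \<open>n+1\<close>, at the point \<open>d i\<close>. The integrals of every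
    bounded continuous function converge, for every \<open>\<omega>\<close> (\<open>discretisation_converges\<close>). Since the
    discretised random measure takes finitely many values, this also shows that
    \<open>g (\<xi> \<omega>)\<close> is measurable for every continuous \<open>g\<close>, and dominated convergence gives the
    convergence of the expectations.

  \<^item> Perturbation. The masses are independent because the cells are disjoint, so their joint law is
    a product of laws on \<open>{0, ..., m}\<close>. Tilting such a law by \<open>k \<mapsto> r^k\<close> divides the roots
    of its generating polynomial by \<open>r\<close>; finitely many values of \<open>r\<close> put a root on the unit circle,
    so \<open>r\<close> arbitrarily close to 1 can be chosen such that there is none
    (\<open>zero_free_approximation\<close>). The total variation distance to the original product
    law can be made at most \<open>1/(n+1)\<close>, and this bounds the change of the expectation of every \<open>g\<close>
    with \<open>\<bar>g\<bar> \<le> 1\<close>.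

  \<^item> Quasi-infinite divisibility. The mass of a Borel set under the perturbed random measure is
    a lattice variable whose generating polynomial is a product of polynomials without roots on the
    unit circle. Splitting such a polynomial into linear factors and expanding the logarithm of each
    factor in powers of \<open>z\<close> or of \<open>1/z\<close> writes it on the circle as
    \<open>exp (i m t + (\<Sum>k. b k * (exp (i k t) - 1)))\<close> with real, absolutely summable \<open>b\<close>
    (\<open>real_laurent_log\<close>). Hence the quasi-Levy measure charges \<open>h k\<close> with mass \<open>b k\<close>
    (\<open>qid_poly\<close>).

  The vague and the weak topology are both generated by integrals of bounded continuous functions,
  so one argument covers them.
\<close>


section \<open>Logarithms of polynomials on the unit circle\<close>

text \<open>A continuous logarithm along the circle with absolutely summable Fourier coefficients, up to the
  winding number \<open>m\<close>. The constant term of the logarithm is \<open>c 0\<close>.\<close>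

definition has_laurent_log :: "(real \<Rightarrow> complex) \<Rightarrow> bool" where
  "has_laurent_log f \<longleftrightarrow>
     (\<exists>(m::int) (c::int \<Rightarrow> complex). integrable (count_space UNIV) c \<and>
        (\<forall>t. f t = exp (\<i> * of_real (of_int m * t)
                     + (\<integral>k. c k * cis (of_int k * t) \<partial>count_space UNIV))))"

lemma integrable_laurent:
  assumes "integrable (count_space UNIV) (c :: int \<Rightarrow> complex)"
  shows "integrable (count_space UNIV) (\<lambda>k. c k * cis (of_int k * t))"
  by (rule Bochner_Integration.integrable_bound[OF assms]) (auto simp: norm_mult)

lemma has_laurent_log_mult:
  assumes "has_laurent_log f" "has_laurent_log g"
  shows "has_laurent_log (\<lambda>t. f t * g t)"
proof -
  obtain m c where f: "integrable (count_space UNIV) c"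
     "\<And>t. f t = exp (\<i> * of_real (of_int m * t)
         + (\<integral>k. c k * cis (of_int k * t) \<partial>count_space UNIV))"
    using assms(1) unfolding has_laurent_log_def by blast
  obtain n d where g: "integrable (count_space UNIV) d"
     "\<And>t. g t = exp (\<i> * of_real (of_int n * t)
         + (\<integral>k. d k * cis (of_int k * t) \<partial>count_space UNIV))"
    using assms(2) unfolding has_laurent_log_def by blast
  show ?thesis
    unfolding has_laurent_log_def
  proof (intro exI[of _ "m + n"] exI[of _ "\<lambda>k. c k + d k"] conjI allI)
    show "integrable (count_space UNIV) (\<lambda>k. c k + d k)"
      using f g by simp
    show "f t * g t = exp (\<i> * of_real (of_int (m + n) * t)
         + (\<integral>k. (c k + d k) * cis (of_int k * t) \<partial>count_space UNIV))" for t
    proof -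
      have "(\<integral>k. (c k + d k) * cis (of_int k * t) \<partial>count_space UNIV)
        = (\<integral>k. c k * cis (of_int k * t) \<partial>count_space UNIV)
          + (\<integral>k. d k * cis (of_int k * t) \<partial>count_space UNIV)"
        unfolding distrib_right
        by (rule Bochner_Integration.integral_add; rule integrable_laurent[OF f(1)] integrable_laurent[OF g(1)])
      then show ?thesis by (simp add: f(2) g(2) exp_add[symmetric] algebra_simps)
    qed
  qed
qed

lemma has_laurent_log_const:
  assumes "a \<noteq> 0"
  shows "has_laurent_log (\<lambda>_. a)"
proof -
  let ?c = "\<lambda>k::int. if k = 0 then Ln a else 0"
  have "(\<integral>k. ?c k * cis (of_int k * t) \<partial>count_space UNIV) = Ln a" for t
  proof -
    have "(\<integral>k. ?c k * cis (of_int k * t) \<partial>count_space UNIV)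
        = infsetsum (\<lambda>k. ?c k * cis (of_int k * t)) UNIV"
      by (simp add: infsetsum_def)
    also have "\<dots> = infsetsum (\<lambda>k. ?c k * cis (of_int k * t)) {0}"
      by (rule infsetsum_cong_neutral) auto
    finally show ?thesis by simp
  qed
  moreover have "integrable (count_space UNIV) ?c"
    unfolding abs_summable_on_def[symmetric]
    by (subst abs_summable_on_cong_neutral[where B = "{0}" and g = ?c]) auto
  ultimately show ?thesis
    unfolding has_laurent_log_def using assms
    by (intro exI[of _ 0] exI[of _ "\<lambda>k. if k = 0 then Ln a else 0"]) simp
qed

text \<open>The logarithmic series of \<open>1 - w\<close> at \<open>w = b * exp (i s t)\<close>; the sign \<open>s\<close> selects whether its
  Fourier modes are the nonnegative or the nonpositive ones.\<close>

lemma has_laurent_log_one_minus: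
  assumes b: "norm b < 1" and s: "s = 1 \<or> s = (-1::int)"
  shows "has_laurent_log (\<lambda>t. 1 - b * cis (of_int s * t))"
proof -
  define f where "f n = - (b ^ n) / of_nat n" for n
  define c where "c k = (if s * k \<ge> 0 then f (nat (s * k)) else 0)" for k
  define g where "g n = s * int n" for n
  have inj: "inj g" and ss: "s * s = 1"
    using s by (auto simp: g_def inj_on_def)
  have cg: "c (g n) = f n" for n
    using s by (auto simp: c_def g_def)
  have c0: "c k = 0" if "k \<notin> range g" for k
  proof -
    have "s * k < 0"
    proof (rule ccontr)
      assume "\<not> s * k < 0"
      then have "g (nat (s * k)) = s * (s * k)" by (simp add: g_def)
      also have "\<dots> = k" using ss by (simp flip: mult.assoc)
      finally show False using that by (metis rangeI)
    qed
    then show ?thesis by (simp add: c_def)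
  qed
  have "summable (\<lambda>n. norm (f n))"
  proof (rule summable_comparison_test)
    show "\<exists>N. \<forall>n\<ge>N. norm (norm (f n)) \<le> norm b ^ n"
    proof (intro exI[of _ 1] allI impI)
      fix n :: nat assume "n \<ge> 1"
      then have "norm b ^ n / real n \<le> norm b ^ n / 1" by (intro frac_le) auto
      then show "norm (norm (f n)) \<le> norm b ^ n"
        by (simp add: f_def norm_divide norm_power)
    qed
    show "summable (\<lambda>n. norm b ^ n)"
      using b by (simp add: summable_geometric)
  qed
  then have fs: "integrable (count_space UNIV) f"
    by (simp add: integrable_count_space_nat_iff)
  have cs: "integrable (count_space UNIV) c"
    unfolding abs_summable_on_def[symmetric]
    using fs[folded abs_summable_on_def] abs_summable_on_reindex[of c g UNIV]
    by (subst abs_summable_on_cong_neutral[where B = "range g" and g = c])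
       (auto simp: cg c0)
  have "(\<integral>k. c k * cis (of_int k * t) \<partial>count_space UNIV) = Ln (1 - b * cis (of_int s * t))" for t
  proof -
    have "(\<integral>k. c k * cis (of_int k * t) \<partial>count_space UNIV)
        = infsetsum (\<lambda>k. c k * cis (of_int k * t)) UNIV"
      by (simp add: infsetsum_def)
    also have "\<dots> = infsetsum (\<lambda>k. c k * cis (of_int k * t)) (range g)"
      by (rule infsetsum_cong_neutral) (auto simp: c0)
    also have "\<dots> = infsetsum (\<lambda>n. f n * cis (of_int (g n) * t)) UNIV"
      using inj by (subst infsetsum_reindex) (auto simp: cg)
    also have "\<dots> = (\<Sum>n. f n * cis (of_int (g n) * t))"
      by (intro infsetsum_nat' abs_summable_on_comparison_test[OF fs[folded abs_summable_on_def]])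
         (auto simp: norm_mult)
    also have "\<dots> = Ln (1 - b * cis (of_int s * t))"
    proof -
      have "(\<lambda>n. - ((b * cis (of_int s * t)) ^ n) / of_nat n) sums Ln (1 + - (b * cis (of_int s * t)))"
        using Ln_series'[of "- (b * cis (of_int s * t))"] b by (simp add: norm_mult)
      moreover have "- ((b * cis (of_int s * t)) ^ n) / of_nat n = f n * cis (of_int (g n) * t)" for n
        by (simp add: f_def g_def power_mult_distrib Complex.DeMoivre mult_ac)
      ultimately show ?thesis by (simp add: sums_iff)
    qed
    finally show ?thesis .
  qed
  moreover have "1 - b * cis (of_int s * t) \<noteq> 0" for t
  proof
    assume "1 - b * cis (of_int s * t) = 0"
    then have "b * cis (of_int s * t) = 1" by simp
    then have "norm (b * cis (of_int s * t)) = 1" by simp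
    then show False using b by (simp add: norm_mult)
  qed
  ultimately show ?thesis
    unfolding has_laurent_log_def using cs
    by (intro exI[of _ 0] exI[of _ c]) simp
qed

text \<open>A root inside the disc contributes one turn of the winding number and a series in \<open>1/z\<close>,
  a root outside the disc contributes a series in \<open>z\<close>.\<close>

lemma has_laurent_log_linear:
  assumes "norm a \<noteq> 1"
  shows "has_laurent_log (\<lambda>t. cis t - a)"
proof (cases "norm a < 1")
  case True
  have "has_laurent_log cis"
    unfolding has_laurent_log_def
    by (intro exI[of _ 1] exI[of _ "\<lambda>_. 0"]) (simp add: cis_conv_exp)
  from has_laurent_log_mult[OF this has_laurent_log_one_minus[OF True, of "-1"]]
  show ?thesis by (simp add: algebra_simps cis_mult)
next
  case False
  then have a: "a \<noteq> 0" "norm (1 / a) < 1" using assms by (auto simp: norm_divide divide_simps)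
  from has_laurent_log_mult[OF has_laurent_log_const[of "- a"] has_laurent_log_one_minus[OF a(2), of 1]] a(1)
  show ?thesis by (simp add: algebra_simps)
qed

lemma has_laurent_log_poly:
  fixes p :: "complex poly"
  assumes "\<And>z. norm z = 1 \<Longrightarrow> poly p z \<noteq> 0"
  shows "has_laurent_log (\<lambda>t. poly p (cis t))"
  using assms
proof (induction "degree p" arbitrary: p)
  case 0
  then obtain a where "p = [:a:]" by (metis degree_eq_zeroE)
  with 0(2)[of 1] show ?case by (simp add: has_laurent_log_const)
next
  case (Suc n)
  then have "\<not> constant (poly p)" by (simp add: constant_degree)
  then obtain a where a: "poly p a = 0"
    using fundamental_theorem_of_algebra by blast
  then obtain q where q: "p = [:- a, 1:] * q"
    by (metis poly_eq_0_iff_dvd dvdE)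
  have "q \<noteq> 0" using q Suc.hyps(2) by auto
  then have "degree p = Suc (degree q)" unfolding q by (subst degree_mult_eq) auto
  then have "n = degree q" using Suc.hyps(2) by simp
  moreover have "poly q z \<noteq> 0" if "norm z = 1" for z
    using Suc.prems[OF that] by (auto simp: q)
  ultimately have "has_laurent_log (\<lambda>t. poly q (cis t))" by (rule Suc.hyps(1))
  moreover have "norm a \<noteq> 1" using a Suc.prems by blast
  ultimately have "has_laurent_log (\<lambda>t. (cis t - a) * poly q (cis t))"
    by (intro has_laurent_log_mult has_laurent_log_linear)
  then show ?case by (simp add: q algebra_simps)
qed

lemma continuous_laurent:
  assumes "integrable (count_space UNIV) (c :: int \<Rightarrow> complex)"
  shows "continuous_on UNIV (\<lambda>t. \<integral>k. c k * cis (of_int k * t) \<partial>count_space UNIV)"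
  unfolding continuous_on_sequentially
proof (intro allI ballI impI, unfold comp_def)
  fix x :: "nat \<Rightarrow> real" and a assume "(\<forall>n. x n \<in> UNIV) \<and> x \<longlonglongrightarrow> a"
  then show "(\<lambda>n. \<integral>k. c k * cis (of_int k * x n) \<partial>count_space UNIV)
      \<longlonglongrightarrow> (\<integral>k. c k * cis (of_int k * a) \<partial>count_space UNIV)"
    using assms
    by (intro integral_dominated_convergence[where w = "\<lambda>k. norm (c k)"] )
       (auto simp: norm_mult intro!: tendsto_intros)
qed

text \<open>Realness of the coefficients is where the symmetry of \<open>p\<close> enters. The logarithm \<open>S c\<close> and the one
  with conjugated coefficients exponentiate to the same function, so their difference is a continuous
  function with values in \<open>2 \<pi> i \<int>\<close>, hence constant; replacing \<open>c\<close> by \<open>Re c\<close>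
  therefore changes the logarithm by a constant only, which cancels by \<open>P 1 = 1\<close>.\<close>

lemma real_laurent_log:
  fixes p :: "complex poly"
  defines "P \<equiv> poly p"
  assumes nz: "\<And>z. norm z = 1 \<Longrightarrow> P z \<noteq> 0" and one: "P 1 = 1"
    and cnjP: "\<And>z. cnj (P z) = P (cnj z)"
  obtains m :: int and b :: "int \<Rightarrow> real" where
    "integrable (count_space UNIV) b" "b 0 = 0"
    "\<And>t. P (cis t) = exp (\<i> * of_real (of_int m * t)
         + (\<integral>k. of_real (b k) * (cis (of_int k * t) - 1) \<partial>count_space UNIV))"
proof -
  obtain m c where c: "integrable (count_space UNIV) (c :: int \<Rightarrow> complex)"
    and P: "\<And>t. P (cis t) = exp (\<i> * of_real (of_int m * t)
         + (\<integral>k. c k * cis (of_int k * t) \<partial>count_space UNIV))"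
    using has_laurent_log_poly[of p] nz unfolding has_laurent_log_def P_def
    by blast
  define S where "S c t = (\<integral>k. c k * cis (of_int k * t) \<partial>count_space UNIV)"
    for c :: "int \<Rightarrow> complex" and t
  \<comment> \<open>difference of the two logarithms of \<open>P\<close>, which turns out to be constant\<close>
  define D where "D = S (\<lambda>k. c k - cnj (c k))"
  have ccnj: "integrable (count_space UNIV) (\<lambda>k. cnj (c k))"
    using c by simp
  have D: "D t = S c t - S (\<lambda>k. cnj (c k)) t" for t
    unfolding D_def S_def using integrable_laurent[OF c, of t] integrable_laurent[OF ccnj, of t]
    by (simp add: left_diff_distrib)
  have cnjS: "cnj (S c (- t)) = S (\<lambda>k. cnj (c k)) t" for t
    unfolding S_def by (simp add: cis_cnj flip: Bochner_Integration.integral_cnj)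
  have "exp (D t) = 1" for t
  proof -
    have "P (cis t) = cnj (P (cis (- t)))" by (simp add: cnjP cis_cnj)
    also have "\<dots> = exp (\<i> * of_real (of_int m * t) + S (\<lambda>k. cnj (c k)) t)"
      unfolding P S_def[symmetric] exp_cnj complex_cnj_add cnjS by simp
    finally have "exp (\<i> * of_real (of_int m * t) + S c t)
       = exp (\<i> * of_real (of_int m * t) + S (\<lambda>k. cnj (c k)) t)"
      by (simp add: P S_def)
    then show ?thesis by (simp add: D exp_add exp_diff)
  qed
  have "D constant_on UNIV"
  proof (rule continuous_discrete_range_constant)
    show "continuous_on UNIV D"
      unfolding D_def S_def using c by (intro continuous_laurent) simp
    show "\<exists>e>0. \<forall>y. y \<in> UNIV \<and> D y \<noteq> D x \<longrightarrow> e \<le> norm (D y - D x)" for x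
    \<comment> \<open>distinct points of \<open>2 \<pi> i \<int>\<close> are at least \<open>2 \<pi>\<close> apart\<close>
    proof (intro exI[of _ "2 * pi"] conjI allI impI)
      fix y assume ne: "y \<in> UNIV \<and> D y \<noteq> D x"
      obtain i where i: "D y = D x + of_int (2 * i) * pi * \<i>"
        using \<open>\<And>t. exp (D t) = 1\<close> exp_eq[of "D y" "D x"] by auto
      with ne have "i \<noteq> 0" by auto
      then have "1 \<le> \<bar>real_of_int i\<bar>" by linarith
      then show "2 * pi \<le> norm (D y - D x)"
        by (simp add: i norm_mult)
    qed simp
  qed simp
  then have Dc: "D t = D 0" for t by (auto simp: constant_on_def)
  define b where "b k = (if k = 0 then 0 else Re (c k))" for k
  have b: "integrable (count_space UNIV) b"
    by (rule Bochner_Integration.integrable_bound[OF c]) (auto simp: b_def abs_Re_le_cmod)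
  have Sb: "S c t - S c 0 = (\<integral>k. of_real (b k) * (cis (of_int k * t) - 1) \<partial>count_space UNIV)" for t
  proof -
    have Rc: "integrable (count_space UNIV) (\<lambda>k. complex_of_real (Re (c k)))"
      using c by simp
    have half: "S (\<lambda>k. complex_of_real (Re (c k))) t = S c t - D t / 2" for t
    proof -
      have "S (\<lambda>k. complex_of_real (Re (c k))) t = S (\<lambda>k. (c k + cnj (c k)) / 2) t"
        unfolding S_def by (simp add: complex_add_cnj)
      also have "\<dots> = (S c t + S (\<lambda>k. cnj (c k)) t) / 2"
        unfolding S_def using integrable_laurent[OF c, of t] integrable_laurent[OF ccnj, of t]
        by (simp add: algebra_simps add_divide_distrib)
      finally show ?thesis by (simp add: D field_simps)
    qed
    have "S c t - S c 0
       = S (\<lambda>k. complex_of_real (Re (c k))) t - S (\<lambda>k. complex_of_real (Re (c k))) 0"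
      unfolding half using Dc[of t] by simp
    also have "\<dots> = (\<integral>k. of_real (Re (c k)) * cis (of_int k * t) - of_real (Re (c k)) * cis (of_int k * 0)
         \<partial>count_space UNIV)"
      unfolding S_def by (rule Bochner_Integration.integral_diff[symmetric]; rule integrable_laurent[OF Rc])
    also have "\<dots> = (\<integral>k. of_real (b k) * (cis (of_int k * t) - 1) \<partial>count_space UNIV)"
      by (rule Bochner_Integration.integral_cong) (auto simp: b_def algebra_simps)
    finally show ?thesis .
  qed
  have "exp (S c 0) = 1" using P[of 0] one by (simp add: S_def)
  then have "P (cis t) = exp (\<i> * of_real (of_int m * t)
         + (\<integral>k. of_real (b k) * (cis (of_int k * t) - 1) \<partial>count_space UNIV))" for t
    unfolding Sb[symmetric] using P[of t] by (simp add: S_def exp_add exp_diff)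
  then show thesis using that b by (simp add: b_def)
qed

section \<open>Differences of finite measures as quasi-Levy type measures\<close>

lemma sets_off_zero: "B \<in> sets (off_zero r) \<longleftrightarrow> B \<in> sets borel \<and> B \<inter> {-r<..<r} = {}"
  unfolding off_zero_def by (subst sets_restrict_space_iff) auto

text \<open>If \<open>N1\<close> lives on \<open>D\<close> and \<open>N2\<close> on its complement, the supremum in the positive variation on \<open>A\<close> is
  attained at \<open>A \<inter> D\<close>. Keeping \<open>N1\<close> away from 0 makes the supremum over \<open>r\<close> attained as well.\<close>

lemma ql_pos_difference:
  assumes N1: "sets N1 = sets borel" "finite_measure N1"
    and N2: "sets N2 = sets borel" "finite_measure N2"
    and D: "D \<in> sets borel" "emeasure N2 D = 0" "emeasure N1 (- D) = 0"
    and r0: "r0 > 0" "emeasure N1 {-r0<..<r0} = 0"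
  shows "ql_pos (\<lambda>A. measure N1 A - measure N2 A) = N1"
proof -
  interpret N1: finite_measure N1 by fact
  interpret N2: finite_measure N2 by fact
  let ?\<nu> = "\<lambda>A. measure N1 A - measure N2 A"
  have var: "pos_variation (off_zero r) ?\<nu> (A - {-r<..<r}) = emeasure N1 (A - {-r<..<r})"
    if A: "A \<in> sets borel" for A r
    unfolding pos_variation_def
  proof (rule antisym)
    show "(SUP B\<in>{B \<in> sets (off_zero r). B \<subseteq> A - {-r<..<r}}. ennreal (?\<nu> B))
        \<le> emeasure N1 (A - {-r<..<r})"
    proof (rule SUP_least)
      fix B assume "B \<in> {B \<in> sets (off_zero r). B \<subseteq> A - {-r<..<r}}"
      then have B: "B \<in> sets borel" "B \<subseteq> A - {-r<..<r}" by (auto simp: sets_off_zero)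
      have "ennreal (?\<nu> B) \<le> ennreal (measure N1 B)" by (intro ennreal_leI) simp
      also have "\<dots> = emeasure N1 B" by (simp add: N1.emeasure_eq_measure)
      also have "\<dots> \<le> emeasure N1 (A - {-r<..<r})"
        using A B by (intro emeasure_mono) (auto simp: N1)
      finally show "ennreal (?\<nu> B) \<le> emeasure N1 (A - {-r<..<r})" .
    qed
    let ?B = "(A - {-r<..<r}) \<inter> D"
    have "emeasure N1 (A - {-r<..<r}) \<le> emeasure N1 (?B \<union> - D)"
      using A D by (intro emeasure_mono) (auto simp: N1)
    also have "\<dots> \<le> emeasure N1 ?B + emeasure N1 (- D)"
      using A D by (intro emeasure_subadditive) (auto simp: N1)
    also have "\<dots> = ennreal (measure N1 ?B)"
      unfolding D(3) add_0_right by (rule N1.emeasure_eq_measure)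
    also have "measure N2 ?B = 0"
    proof -
      have "emeasure N2 ?B \<le> emeasure N2 D" using A D by (intro emeasure_mono) (auto simp: N2)
      then show ?thesis by (simp add: D measure_def)
    qed
    then have "ennreal (measure N1 ?B) = ennreal (?\<nu> ?B)" by simp
    also have "\<dots> \<le> (SUP B\<in>{B \<in> sets (off_zero r). B \<subseteq> A - {-r<..<r}}. ennreal (?\<nu> B))"
      using A D by (intro SUP_upper) (auto simp: sets_off_zero)
    finally show "emeasure N1 (A - {-r<..<r})
       \<le> (SUP B\<in>{B \<in> sets (off_zero r). B \<subseteq> A - {-r<..<r}}. ennreal (?\<nu> B))" .
  qed
  have lim: "(SUP r\<in>{0<..}. emeasure N1 (A - {-r<..<r})) = emeasure N1 A"
    if A: "A \<in> sets borel" for A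
  proof (rule antisym)
    show "(SUP r\<in>{0<..}. emeasure N1 (A - {-r<..<r})) \<le> emeasure N1 A"
      using A by (intro SUP_least emeasure_mono) (auto simp: N1)
    have "emeasure N1 A \<le> emeasure N1 ((A - {-r0<..<r0}) \<union> {-r0<..<r0})"
      using A by (intro emeasure_mono) (auto simp: N1)
    also have "\<dots> \<le> emeasure N1 (A - {-r0<..<r0}) + emeasure N1 {-r0<..<r0}"
      using A by (intro emeasure_subadditive) (auto simp: N1)
    also have "\<dots> = emeasure N1 (A - {-r0<..<r0})" by (simp add: r0)
    also have "\<dots> \<le> (SUP r\<in>{0<..}. emeasure N1 (A - {-r<..<r}))"
      using r0 by (intro SUP_upper) auto
    finally show "emeasure N1 A \<le> (SUP r\<in>{0<..}. emeasure N1 (A - {-r<..<r}))" .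
  qed
  have "ql_pos ?\<nu> = measure_of UNIV (sets borel) (emeasure N1)"
    unfolding ql_pos_def induced_measure_def
  proof (rule measure_of_eq)
    fix A :: "real set" assume "A \<in> sigma_sets UNIV (sets borel)"
    then have A: "A \<in> sets borel" using sets.sigma_sets_eq[of "borel :: real measure"] by simp
    show "(SUP r\<in>{0<..}. pos_variation (off_zero r) ?\<nu> (A - {-r<..<r})) = emeasure N1 A"
      using lim[OF A] by (simp only: var[OF A])
  qed simp
  also have "\<dots> = N1"
    using measure_of_of_measure[of N1] N1(1) sets_eq_imp_space_eq[OF N1(1)] by simp
  finally show ?thesis .
qed

text \<open>The negative variation of \<open>\<nu>\<close> is the positive variation of \<open>- \<nu>\<close>, which amounts to exchanging
  \<open>N1\<close> and \<open>N2\<close>.\<close>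

lemma ql_neg_difference:
  assumes N1: "sets N1 = sets borel" "finite_measure N1"
    and N2: "sets N2 = sets borel" "finite_measure N2"
    and D: "D \<in> sets borel" "emeasure N2 D = 0" "emeasure N1 (- D) = 0"
    and r0: "r0 > 0" "emeasure N2 {-r0<..<r0} = 0"
  shows "ql_neg (\<lambda>A. measure N1 A - measure N2 A) = N2"
proof -
  have "ql_neg (\<lambda>A. measure N1 A - measure N2 A) = ql_pos (\<lambda>A. measure N2 A - measure N1 A)"
    unfolding ql_neg_def ql_pos_def neg_variation_def pos_variation_def by simp
  also have "\<dots> = N2"
    using D by (intro ql_pos_difference[OF N2 N1 _ _ _ r0, of "- D"]) auto
  finally show ?thesis .
qed

text \<open>The total variations are bounded by the total mass of \<open>N1 + N2\<close> uniformly in \<open>r\<close>, which gives the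
  integrability of \<open>min 1 x^2\<close>.\<close>

lemma quasi_levy_type_difference:
  assumes N1: "sets N1 = sets borel" "finite_measure N1"
    and N2: "sets N2 = sets borel" "finite_measure N2"
  shows "quasi_levy_type (\<lambda>A. measure N1 A - measure N2 A)"
  unfolding quasi_levy_type_def
proof (intro conjI allI impI)
  interpret N1: finite_measure N1 by fact
  interpret N2: finite_measure N2 by fact
  let ?\<nu> = "\<lambda>A. measure N1 A - measure N2 A"
  show "finite_signed_measure (off_zero r) ?\<nu>" for r
    unfolding finite_signed_measure_def
  proof (intro conjI allI impI)
    fix A :: "nat \<Rightarrow> real set"
    assume A: "range A \<subseteq> sets (off_zero r) \<and> disjoint_family A"
    then have "range A \<subseteq> sets borel" by (auto simp: sets_off_zero)
    with A show "(\<lambda>i. ?\<nu> (A i)) sums ?\<nu> (\<Union>i. A i)"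
      by (intro sums_diff N1.finite_measure_UNION N2.finite_measure_UNION) (auto simp: N1 N2)
  qed simp
  have bound: "total_variation (off_zero r) ?\<nu> A \<le> emeasure N1 UNIV + emeasure N2 UNIV" for r A
    unfolding total_variation_def
  proof (rule SUP_least)
    fix P
    assume "P \<in> {P. finite P \<and> P \<subseteq> sets (off_zero r) \<and> disjoint P \<and> \<Union>P = A}"
    then have P: "finite P" "P \<subseteq> sets borel" "disjoint_family_on (\<lambda>B. B) P"
      by (auto simp: sets_off_zero disjoint_def disjoint_family_on_def)
    have "(\<Sum>B\<in>P. ennreal \<bar>?\<nu> B\<bar>) \<le> (\<Sum>B\<in>P. emeasure N1 B + emeasure N2 B)"
    proof (rule sum_mono)
      fix B
      have "\<bar>?\<nu> B\<bar> \<le> measure N1 B + measure N2 B"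
        using measure_nonneg[of N1 B] measure_nonneg[of N2 B] by linarith
      then show "ennreal \<bar>?\<nu> B\<bar> \<le> emeasure N1 B + emeasure N2 B"
        by (simp add: N1.emeasure_eq_measure N2.emeasure_eq_measure ennreal_plus[symmetric]
            ennreal_leI del: ennreal_plus)
    qed
    also have "\<dots> = emeasure N1 (\<Union>B\<in>P. B) + emeasure N2 (\<Union>B\<in>P. B)"
      unfolding sum.distrib using P by (subst (1 2) sum_emeasure) (auto simp: N1 N2)
    also have "\<dots> \<le> emeasure N1 UNIV + emeasure N2 UNIV"
      by (intro add_mono emeasure_mono) (auto simp: N1 N2)
    finally show "(\<Sum>B\<in>P. ennreal \<bar>?\<nu> B\<bar>) \<le> emeasure N1 UNIV + emeasure N2 UNIV" .
  qed
  have "(\<integral>\<^sup>+x. ennreal (min 1 (x\<^sup>2)) \<partial>ql_abs ?\<nu>) \<le> (\<integral>\<^sup>+x. 1 \<partial>ql_abs ?\<nu>)"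
    by (intro nn_integral_mono) (simp add: ennreal_le_1)
  also have "\<dots> = emeasure (ql_abs ?\<nu>) (space (ql_abs ?\<nu>))" by simp
  also have "\<dots> \<le> emeasure N1 UNIV + emeasure N2 UNIV"
    unfolding ql_abs_def induced_measure_def
    \<comment> \<open>\<open>measure_of\<close> never exceeds the set function it is built from, additive or not\<close>
    by (subst emeasure_measure_of_conv) (auto intro!: SUP_least bound)
  also have "\<dots> < \<infinity>"
    by (simp add: N1.emeasure_eq_measure N2.emeasure_eq_measure flip: ennreal_plus)
  finally show "(\<integral>\<^sup>+x. ennreal (min 1 (x\<^sup>2)) \<partial>ql_abs ?\<nu>) < \<infinity>" .
qed

section \<open>Lattice laws without zeros of the characteristic function\<close>

definition lattice_measure :: "real \<Rightarrow> (int \<Rightarrow> real) \<Rightarrow> real measure" where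
  "lattice_measure h c = distr (density (count_space UNIV) (\<lambda>k. ennreal (c k))) borel (\<lambda>k. h * of_int k)"

lemma lattice_measure_props:
  assumes c: "integrable (count_space UNIV) c" and nonneg: "\<And>k. c k \<ge> 0"
  shows sets_lattice_measure: "sets (lattice_measure h c) = sets borel"
    and finite_measure_lattice_measure: "finite_measure (lattice_measure h c)"
    and null_lattice_measure:
      "A \<in> sets borel \<Longrightarrow> (\<And>k. h * of_int k \<in> A \<Longrightarrow> c k = 0) \<Longrightarrow> emeasure (lattice_measure h c) A = 0"
    and integral_lattice_measure:
      "g \<in> borel_measurable borel \<Longrightarrow>
       (\<integral>x. g x \<partial>lattice_measure h c) = (\<integral>k. of_real (c k) * (g (h * of_int k) :: complex) \<partial>count_space UNIV)"
proof -
  show "sets (lattice_measure h c) = sets borel" by (simp add: lattice_measure_def)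
  have em: "emeasure (lattice_measure h c) A
      = (\<integral>\<^sup>+k. ennreal (c k) * indicator ((\<lambda>k. h * of_int k) -` A) k \<partial>count_space UNIV)"
    if "A \<in> sets borel" for A
    unfolding lattice_measure_def using that
    by (subst emeasure_distr) (auto simp: emeasure_density)
  show "finite_measure (lattice_measure h c)"
  proof (rule finite_measureI)
    have "emeasure (lattice_measure h c) (space (lattice_measure h c))
        = (\<integral>\<^sup>+k. ennreal (c k) \<partial>count_space UNIV)"
      using em[of UNIV] by (simp add: lattice_measure_def)
    also have "\<dots> = ennreal (\<integral>k. c k \<partial>count_space UNIV)"
      using c nonneg by (intro nn_integral_eq_integral) auto
    finally show "emeasure (lattice_measure h c) (space (lattice_measure h c)) \<noteq> \<infinity>" by simp
  qed
  show "emeasure (lattice_measure h c) A = 0"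
    if "A \<in> sets borel" "\<And>k. h * of_int k \<in> A \<Longrightarrow> c k = 0"
    using that by (subst em) (auto simp: nn_integral_0_iff_AE AE_count_space indicator_def)
  show "(\<integral>x. g x \<partial>lattice_measure h c)
      = (\<integral>k. of_real (c k) * (g (h * of_int k) :: complex) \<partial>count_space UNIV)"
    if "g \<in> borel_measurable borel"
    unfolding lattice_measure_def using that nonneg
    by (subst integral_distr; (subst integral_density)?) (auto simp: scaleR_conv_of_real)
qed

text \<open>The quasi-Levy type measure with mass \<open>b k\<close> at \<open>h k\<close>. The part with \<open>b k > 0\<close> and the part with
  \<open>b k < 0\<close> sit on disjoint countable sets outside \<open>(-h, h)\<close>, so that they are the two variations.\<close>

lemma qid_exponent_lattice:
  fixes b :: "int \<Rightarrow> real"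
  assumes b: "integrable (count_space UNIV) b" "b 0 = 0" and h: "h > 0"
  obtains \<nu> where "quasi_levy_type \<nu>"
    "\<And>g :: real \<Rightarrow> complex. g \<in> borel_measurable borel \<Longrightarrow> bounded (range g) \<Longrightarrow>
       ql_integral \<nu> g = (\<integral>k. of_real (b k) * g (h * of_int k) \<partial>count_space UNIV)"
proof -
  let ?p = "\<lambda>k. max 0 (b k)" and ?n = "\<lambda>k. max 0 (- b k)"
  have p: "integrable (count_space UNIV) ?p" and n: "integrable (count_space UNIV) ?n"
    by (rule Bochner_Integration.integrable_bound[OF b(1)]; simp)+
  define N1 where "N1 = lattice_measure h ?p"
  define N2 where "N2 = lattice_measure h ?n"
  note N1 = lattice_measure_props[of ?p, OF p max.cobounded1, where h = h, folded N1_def]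
  note N2 = lattice_measure_props[of ?n, OF n max.cobounded1, where h = h, folded N2_def]
  define D where "D = (\<lambda>k. h * of_int k) ` {k. b k > 0}"
  have D: "D \<in> sets borel"
  proof (rule sets.countable)
    show "countable D" unfolding D_def by (rule countable_image) (rule countableI_type)
  qed simp
  have kD: "h * of_int k \<in> D \<longleftrightarrow> b k > 0" for k
    using h by (auto simp: D_def)
  have D1: "emeasure N1 (- D) = 0"
    by (rule N1(3)) (use D kD in auto)
  have D2: "emeasure N2 D = 0"
    by (rule N2(3)) (use D kD in auto)
  have k0: "k = 0" if "h * real_of_int k \<in> {-h<..<h}" for k
  proof -
    have "h * real_of_int k < h * 1" "h * (- 1) < h * real_of_int k" using that by auto
    then have "real_of_int k < 1" "- 1 < real_of_int k"
      using h mult_less_cancel_left_pos by blast+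
    then show ?thesis by linarith
  qed
  have R1: "emeasure N1 {-h<..<h} = 0"
  proof (rule N1(3))
    show "max 0 (b k) = 0" if "h * real_of_int k \<in> {-h<..<h}" for k
      using k0[OF that] b(2) by simp
  qed simp
  have R2: "emeasure N2 {-h<..<h} = 0"
  proof (rule N2(3))
    show "max 0 (- b k) = 0" if "h * real_of_int k \<in> {-h<..<h}" for k
      using k0[OF that] b(2) by simp
  qed simp
  define \<nu> where "\<nu> = (\<lambda>A. measure N1 A - measure N2 A)"
  have pos: "ql_pos \<nu> = N1" and neg: "ql_neg \<nu> = N2"
    unfolding \<nu>_def
    by (rule ql_pos_difference[OF N1(1,2) N2(1,2) D D2 D1 h R1],
        rule ql_neg_difference[OF N1(1,2) N2(1,2) D D2 D1 h R2])
  show thesis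
  proof
    show "quasi_levy_type \<nu>"
      unfolding \<nu>_def by (rule quasi_levy_type_difference[OF N1(1,2) N2(1,2)])
    fix g :: "real \<Rightarrow> complex" assume g: "g \<in> borel_measurable borel" "bounded (range g)"
    then obtain K where K: "\<And>x. norm (g x) \<le> K" by (auto simp: bounded_iff)
    have int: "integrable (count_space UNIV) (\<lambda>k. of_real (c k) * g (h * of_int k))"
      if c: "integrable (count_space UNIV) c" for c :: "int \<Rightarrow> real"
    proof (rule Bochner_Integration.integrable_bound)
      show "integrable (count_space UNIV) (\<lambda>k. K * c k)" using c by simp
      have "norm (c k) * norm (g (h * of_int k)) \<le> norm (c k) * \<bar>K\<bar>" for k
        using K[of "h * of_int k"] by (intro mult_left_mono) auto
      then show "AE k in count_space UNIV. norm (of_real (c k) * g (h * of_int k)) \<le> norm (K * c k)"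
        by (simp add: AE_count_space norm_mult abs_mult mult.commute)
    qed simp
    have "ql_integral \<nu> g = (\<integral>k. of_real (?p k) * g (h * of_int k) - of_real (?n k) * g (h * of_int k)
        \<partial>count_space UNIV)"
      unfolding ql_integral_def pos neg N1(4)[OF g(1)] N2(4)[OF g(1)]
      by (rule Bochner_Integration.integral_diff[symmetric]; rule int[OF p] int[OF n])
    also have "\<dots> = (\<integral>k. of_real (b k) * g (h * of_int k) \<partial>count_space UNIV)"
      by (rule Bochner_Integration.integral_cong) (auto simp: max_def)
    finally show "ql_integral \<nu> g = (\<integral>k. of_real (b k) * g (h * of_int k) \<partial>count_space UNIV)" .
  qed
qed

lemma centering_measurable [measurable]: "centering \<in> borel_measurable borel"
  unfolding centering_def by measurable

lemma abs_centering_le: "\<bar>centering x\<bar> \<le> 1"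
  by (auto simp: centering_def)

text \<open>The compensating terms \<open>i \<theta> \<tau>(h k)\<close> are summable against \<open>b\<close> and are absorbed, together with
  the winding number, by the drift \<open>\<gamma>\<close>; the Gaussian coefficient is 0.\<close>

lemma qid_poly:
  fixes p :: "complex poly"
  defines "P \<equiv> poly p"
  assumes nz: "\<And>z. norm z = 1 \<Longrightarrow> P z \<noteq> 0" and one: "P 1 = 1"
    and cnjP: "\<And>z. cnj (P z) = P (cnj z)" and h: "h > 0"
  shows "\<exists>\<gamma> a \<nu>. quasi_levy_type \<nu> \<and> (\<forall>\<theta>. P (cis (h * \<theta>)) = exp (qid_exponent \<gamma> a \<nu> \<theta>))"
proof -
  obtain m b where b: "integrable (count_space UNIV) b" "b 0 = 0"
    and P: "\<And>t. P (cis t) = exp (\<i> * of_real (of_int m * t)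
         + (\<integral>k. of_real (b k) * (cis (of_int k * t) - 1) \<partial>count_space UNIV))"
    by (rule real_laurent_log[of p, folded P_def, OF nz one cnjP]; (assumption | (rule that; assumption)))
  obtain \<nu> where \<nu>: "quasi_levy_type \<nu>"
    "\<And>g :: real \<Rightarrow> complex. g \<in> borel_measurable borel \<Longrightarrow> bounded (range g) \<Longrightarrow>
       ql_integral \<nu> g = (\<integral>k. of_real (b k) * g (h * of_int k) \<partial>count_space UNIV)"
    by (rule qid_exponent_lattice[OF b h]) (rule that; assumption)
  define q where "q = (\<integral>k. b k * centering (h * of_int k) \<partial>count_space UNIV)"
  define \<gamma> where "\<gamma> = of_int m * h + q"
  have icen: "integrable (count_space UNIV) (\<lambda>k. b k * centering (h * of_int k))"
    by (rule Bochner_Integration.integrable_bound[OF b(1)])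
       (auto simp: abs_mult mult_left_le[OF abs_centering_le abs_ge_zero])
  have "P (cis (h * \<theta>)) = exp (qid_exponent \<gamma> 0 \<nu> \<theta>)" for \<theta>
  proof -
    let ?g = "\<lambda>x. exp (\<i> * of_real (\<theta> * x)) - 1 - \<i> * of_real (\<theta> * centering x)"
    have "norm (?g x) \<le> 2 + \<bar>\<theta>\<bar>" for x
    proof -
      have "norm (?g x) \<le> norm (exp (\<i> * of_real (\<theta> * x))) + norm (1::complex)
          + norm (\<i> * of_real (\<theta> * centering x))"
        by (intro order.trans[OF norm_triangle_ineq4] add_mono) auto
      also have "\<dots> \<le> 2 + \<bar>\<theta>\<bar>"
        using mult_left_le[OF abs_centering_le abs_ge_zero, of \<theta> x]
        by (simp add: norm_mult abs_mult)
      finally show ?thesis .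
    qed
    then have "bounded (range ?g)" by (auto simp: bounded_iff)
    then have "ql_integral \<nu> ?g = (\<integral>k. of_real (b k) * ?g (h * of_int k) \<partial>count_space UNIV)"
      by (intro \<nu>) measurable
    also have "\<dots> = (\<integral>k. of_real (b k) * (cis (of_int k * (h * \<theta>)) - 1)
         - \<i> * of_real \<theta> * of_real (b k * centering (h * of_int k)) \<partial>count_space UNIV)"
    proof (rule Bochner_Integration.integral_cong)
      fix k
      have "exp (\<i> * of_real (\<theta> * (h * of_int k))) = cis (of_int k * (h * \<theta>))"
        unfolding cis_conv_exp by (simp add: mult_ac)
      then show "of_real (b k) * ?g (h * of_int k)
        = of_real (b k) * (cis (of_int k * (h * \<theta>)) - 1)
         - \<i> * of_real \<theta> * of_real (b k * centering (h * of_int k))"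
        by (simp only: of_real_mult) (simp add: algebra_simps)
    qed simp
    also have "\<dots> = (\<integral>k. of_real (b k) * (cis (of_int k * (h * \<theta>)) - 1) \<partial>count_space UNIV)
         - (\<integral>k. \<i> * of_real \<theta> * of_real (b k * centering (h * of_int k)) \<partial>count_space UNIV)"
    proof (rule Bochner_Integration.integral_diff)
      show "integrable (count_space UNIV) (\<lambda>k. complex_of_real (b k) * (cis (of_int k * (h * \<theta>)) - 1))"
        using integrable_laurent[of "\<lambda>k. of_real (b k)" "h * \<theta>"] b(1)
        by (simp add: right_diff_distrib)
      show "integrable (count_space UNIV)
          (\<lambda>k. \<i> * of_real \<theta> * of_real (b k * centering (h * of_int k)))"
        using icen by (intro integrable_mult_right integrable_of_real)
    qed
    also have "(\<integral>k. \<i> * of_real \<theta> * of_real (b k * centering (h * of_int k)) \<partial>count_space UNIV)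
        = \<i> * of_real \<theta> * of_real q"
      unfolding q_def by (simp only: integral_mult_right_zero integral_complex_of_real)
    finally have L: "ql_integral \<nu> ?g
        = (\<integral>k. of_real (b k) * (cis (of_int k * (h * \<theta>)) - 1) \<partial>count_space UNIV)
          - \<i> * of_real \<theta> * of_real q" .
    have "\<i> * of_real (of_int m * (h * \<theta>)) + X
        = \<i> * of_real (\<theta> * \<gamma>) - of_real (\<theta>\<^sup>2 / 2 * 0) + (X - \<i> * of_real \<theta> * of_real q)"
      for X by (simp add: \<gamma>_def algebra_simps)
    then show ?thesis unfolding P qid_exponent_def L by (rule arg_cong)
  qed
  then show ?thesis using \<nu>(1) by blast
qed

section \<open>Removing zeros of the generating polynomial\<close>

text \<open>Probability generating function of a law on \<open>{0, ..., m}\<close>, with complex coefficients so that it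
  can be evaluated on the unit circle.\<close>

definition gen_poly :: "nat \<Rightarrow> nat pmf \<Rightarrow> complex poly" where
  "gen_poly m p = (\<Sum>k\<le>m. monom (of_real (pmf p k)) k)"

lemma poly_gen_poly: "poly (gen_poly m p) z = (\<Sum>k\<le>m. of_real (pmf p k) * z ^ k)"
  by (simp add: gen_poly_def poly_sum poly_monom)

lemma sum_pmf_atMost:
  assumes "set_pmf p \<subseteq> {..m::nat}"
  shows "(\<Sum>k\<le>m. pmf p k) = 1"
  using sum_pmf_eq_1[of "{..m}" p] assms by simp

lemma poly_gen_poly_1: "set_pmf p \<subseteq> {..m} \<Longrightarrow> poly (gen_poly m p) 1 = 1"
  by (simp add: poly_gen_poly sum_pmf_atMost flip: of_real_sum)

lemma pmf_of_weights:
  fixes w :: "nat \<Rightarrow> real"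
  assumes "\<And>k. 0 \<le> w k" "\<And>k. k > m \<Longrightarrow> w k = 0" "(\<Sum>k\<le>m. w k) = 1"
  obtains q where "\<And>k. pmf q k = w k" "set_pmf q \<subseteq> {..m}"
proof -
  have "(\<integral>\<^sup>+k. ennreal (w k) \<partial>count_space UNIV) = (\<Sum>k\<le>m. ennreal (w k))"
    using assms(2) by (intro nn_integral_count_space') (auto simp: not_le[symmetric])
  also have "\<dots> = 1" using assms by (simp add: sum_ennreal)
  finally have 1: "(\<integral>\<^sup>+k. ennreal (w k) \<partial>count_space UNIV) = 1" .
  show thesis
  proof (rule that[of "embed_pmf w"])
    show "pmf (embed_pmf w) k = w k" for k
      by (rule pmf_embed_pmf[OF assms(1) 1])
    show "set_pmf (embed_pmf w) \<subseteq> {..m}"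
      unfolding set_embed_pmf[OF assms(1) 1] using assms(2) by (auto simp: not_le[symmetric])
  qed
qed

text \<open>Exponential tilting: the weights \<open>pmf p k * r^k\<close>, normalised by \<open>Z r\<close>, have the generating polynomial
  \<open>P (r z) / P r\<close>. It vanishes somewhere on the unit circle only if \<open>r\<close> is the modulus of a root of
  \<open>P\<close>, and the tilted weights converge to those of \<open>p\<close> as \<open>r\<close> tends to 1.\<close>

lemma zero_free_approximation:
  assumes p: "set_pmf p \<subseteq> {..m}" and e: "\<epsilon> > 0"
  obtains q where "set_pmf q \<subseteq> {..m}" "\<And>k. \<bar>pmf q k - pmf p k\<bar> \<le> \<epsilon>"
    "\<And>z. norm z = 1 \<Longrightarrow> poly (gen_poly m q) z \<noteq> 0"
proof -
  define Z where "Z r = (\<Sum>k\<le>m. pmf p k * r ^ k)" for r :: real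
  define w where "w r k = pmf p k * r ^ k / Z r" for r k
  define R where "R = norm ` {z. poly (gen_poly m p) z = 0}"
  have p0: "pmf p k = 0" if "k > m" for k
    using p that by (auto simp: set_pmf_eq)
  have "gen_poly m p \<noteq> 0" using poly_gen_poly_1[OF p] by auto
  then have "finite R" unfolding R_def by (simp add: poly_roots_finite)
  then have "eventually (\<lambda>r. \<forall>x\<in>R. r \<noteq> x) (at (1::real))"
    by (intro eventually_ball_finite ballI eventually_neq_at_within)
  then have ev1: "eventually (\<lambda>r. r \<notin> R) (at (1::real))"
    by (rule eventually_mono) auto
  have "Z \<midarrow>1\<rightarrow> Z 1"
    unfolding Z_def[abs_def] by (intro tendsto_intros)
  then have Z: "Z \<midarrow>1\<rightarrow> 1"
    using sum_pmf_atMost[OF p] by (simp add: Z_def)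
  have w: "(\<lambda>r. w r k) \<midarrow>1\<rightarrow> pmf p k" for k
  proof -
    have "(\<lambda>r. pmf p k * r ^ k / Z r) \<midarrow>1\<rightarrow> pmf p k * 1 ^ k / 1"
      by (intro tendsto_intros Z) auto
    then show ?thesis by (simp add: w_def)
  qed
  have "eventually (\<lambda>r. \<forall>k\<in>{..m}. \<bar>w r k - pmf p k\<bar> < \<epsilon>) (at 1)"
    using tendstoD[OF w e] by (intro eventually_ball_finite ballI) (auto simp: dist_real_def)
  moreover have "eventually (\<lambda>r. Z r > 0) (at 1)"
    using order_tendstoD(1)[OF Z, of 0] by simp
  moreover have "eventually (\<lambda>r. r > 0) (at (1::real))"
    using order_tendstoD(1)[OF tendsto_ident_at[of "1::real" UNIV], of 0] by simp
  ultimately have "eventually (\<lambda>r. r \<notin> R \<and> (\<forall>k\<in>{..m}. \<bar>w r k - pmf p k\<bar> < \<epsilon>) \<and> Z r > 0 \<and> r > 0) (at 1)"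
    using ev1 by eventually_elim blast
  then have "\<exists>r. r \<notin> R \<and> (\<forall>k\<in>{..m}. \<bar>w r k - pmf p k\<bar> < \<epsilon>) \<and> Z r > 0 \<and> r > 0"
    by (rule eventually_happens'[OF at_neq_bot])
  then obtain r where r: "r \<notin> R" "\<And>k. k \<le> m \<Longrightarrow> \<bar>w r k - pmf p k\<bar> < \<epsilon>" "Z r > 0" "r > 0"
    by auto
  have "(\<Sum>k\<le>m. w r k) = Z r / Z r"
    unfolding w_def sum_divide_distrib[symmetric] by (simp only: Z_def)
  then have "(\<Sum>k\<le>m. w r k) = 1" using r by simp
  moreover have "w r k \<ge> 0" for k using r by (simp add: w_def)
  moreover have wm: "w r k = 0" if "k > m" for k using p0[OF that] by (simp add: w_def)
  ultimately obtain q where q: "\<And>k. pmf q k = w r k" "set_pmf q \<subseteq> {..m}"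
    using pmf_of_weights[of "w r" m] by blast
  show thesis
  proof (rule that[OF q(2)])
    show "\<bar>pmf q k - pmf p k\<bar> \<le> \<epsilon>" for k
      using r(2)[of k] wm[of k] p0[of k] e by (cases "k \<le> m") (auto simp: q)
    fix z :: complex assume z: "norm z = 1"
    have "poly (gen_poly m q) z = poly (gen_poly m p) (of_real r * z) / of_real (Z r)"
      by (simp add: poly_gen_poly q w_def sum_divide_distrib power_mult_distrib mult_ac)
    moreover have "poly (gen_poly m p) (of_real r * z) \<noteq> 0"
    proof
      assume "poly (gen_poly m p) (of_real r * z) = 0"
      then have "norm (of_real r * z) \<in> R" unfolding R_def by blast
      then show False using r z by (simp add: norm_mult)
    qed
    ultimately show "poly (gen_poly m q) z \<noteq> 0" using r by simp
  qed
qed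

lemma expectation_Pi_pmf_finite:
  assumes "\<And>i. i \<le> n \<Longrightarrow> set_pmf (p i) \<subseteq> {..m}"
  shows "measure_pmf.expectation (Pi_pmf {..n} 0 p) (G :: (nat \<Rightarrow> nat) \<Rightarrow> real)
    = (\<Sum>y\<in>PiE_dflt {..n} 0 (\<lambda>_. {..m}). (\<Prod>i\<le>n. pmf (p i) (y i)) * G y)"
proof -
  have "measure_pmf.expectation (Pi_pmf {..n} 0 p) G
    = (\<Sum>y\<in>PiE_dflt {..n} 0 (\<lambda>_. {..m}). pmf (Pi_pmf {..n} 0 p) y *\<^sub>R G y)"
  proof (rule integral_measure_pmf)
    show "finite (PiE_dflt {..n} 0 (\<lambda>_. {..m}))" by (intro finite_PiE_dflt) auto
    show "y \<in> PiE_dflt {..n} 0 (\<lambda>_. {..m})" if "y \<in> set_pmf (Pi_pmf {..n} 0 p)" for y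
      using that assms by (auto simp: set_Pi_pmf PiE_dflt_def)
  qed
  also have "\<dots> = (\<Sum>y\<in>PiE_dflt {..n} 0 (\<lambda>_. {..m}). (\<Prod>i\<le>n. pmf (p i) (y i)) * G y)"
    by (intro sum.cong refl) (subst pmf_Pi, auto simp: PiE_dflt_def)
  finally show ?thesis .
qed

text \<open>Product laws on a finite grid whose factors have close weights are close in total variation, so the
  bound depends on \<open>G\<close> only through its supremum. The factor \<open>(m + 1)^(n + 1)\<close> counts the grid
  points and \<open>n + 1\<close> the factors of each product weight.\<close>

lemma expectation_Pi_pmf_diff:
  assumes p: "\<And>i. i \<le> n \<Longrightarrow> set_pmf (p i) \<subseteq> {..m}"
    and q: "\<And>i. i \<le> n \<Longrightarrow> set_pmf (q i) \<subseteq> {..m}"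
    and pq: "\<And>i k. i \<le> n \<Longrightarrow> \<bar>pmf (q i) k - pmf (p i) k\<bar> \<le> \<epsilon>"
    and G: "\<And>y. \<bar>G y\<bar> \<le> C"
  shows "\<bar>measure_pmf.expectation (Pi_pmf {..n} 0 q) G - measure_pmf.expectation (Pi_pmf {..n} 0 p) G\<bar>
    \<le> real ((m + 1) ^ (n + 1)) * (real (n + 1) * \<epsilon>) * C"
proof -
  let ?A = "PiE_dflt {..n} 0 (\<lambda>_. {..m}) :: (nat \<Rightarrow> nat) set"
  have C: "C \<ge> 0" using G[of undefined] by linarith
  have "\<bar>measure_pmf.expectation (Pi_pmf {..n} 0 q) G - measure_pmf.expectation (Pi_pmf {..n} 0 p) G\<bar>
     = \<bar>\<Sum>y\<in>?A. ((\<Prod>i\<le>n. pmf (q i) (y i)) - (\<Prod>i\<le>n. pmf (p i) (y i))) * G y\<bar>"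
    using p q by (simp add: expectation_Pi_pmf_finite[where m = m] left_diff_distrib flip: sum_subtractf)
  also have "\<dots> \<le> (\<Sum>y\<in>?A. (real (n + 1) * \<epsilon>) * C)"
  proof (rule order.trans[OF sum_abs sum_mono])
    fix y
    have "\<bar>(\<Prod>i\<le>n. pmf (q i) (y i)) - (\<Prod>i\<le>n. pmf (p i) (y i))\<bar>
        \<le> (\<Sum>i\<le>n. \<bar>pmf (q i) (y i) - pmf (p i) (y i)\<bar>)"
      using norm_prod_diff[of "{..n}" "\<lambda>i. pmf (q i) (y i)" "\<lambda>i. pmf (p i) (y i)"]
      by (simp add: pmf_le_1)
    also have "\<dots> \<le> (\<Sum>i\<le>n. \<epsilon>)" by (intro sum_mono pq) simp
    finally have "\<bar>(\<Prod>i\<le>n. pmf (q i) (y i)) - (\<Prod>i\<le>n. pmf (p i) (y i))\<bar> \<le> real (n + 1) * \<epsilon>"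
      by simp
    then show "\<bar>((\<Prod>i\<le>n. pmf (q i) (y i)) - (\<Prod>i\<le>n. pmf (p i) (y i))) * G y\<bar>
        \<le> (real (n + 1) * \<epsilon>) * C"
      unfolding abs_mult using G[of y] C by (intro mult_mono) auto
  qed
  also have "\<dots> = real ((m + 1) ^ (n + 1)) * (real (n + 1) * \<epsilon>) * C"
    by (simp add: card_PiE_dflt)
  finally show ?thesis .
qed

text \<open>Finitely many independent bounded integer valued variables have a product law, which turns
  expectations on an arbitrary probability space into finite sums. The value 0 outside \<open>{..n}\<close> is the
  default value of the product law.\<close>

lemma (in prob_space) expectation_indep_nat:
  fixes K :: "nat \<Rightarrow> 'a \<Rightarrow> nat"
  assumes ind: "indep_vars (\<lambda>_. count_space UNIV) K {..n}"
    and K: "\<And>i \<omega>. i \<le> n \<Longrightarrow> \<omega> \<in> space M \<Longrightarrow> K i \<omega> \<le> m"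
  obtains p where "\<And>i. i \<le> n \<Longrightarrow> set_pmf (p i) \<subseteq> {..m}"
    "\<And>G :: (nat \<Rightarrow> nat) \<Rightarrow> real. integrable M (\<lambda>\<omega>. G (\<lambda>i. if i \<le> n then K i \<omega> else 0))"
    "\<And>G :: (nat \<Rightarrow> nat) \<Rightarrow> real. expectation (\<lambda>\<omega>. G (\<lambda>i. if i \<le> n then K i \<omega> else 0))
       = measure_pmf.expectation (Pi_pmf {..n} 0 p) G"
proof -
  let ?E = "\<lambda>i k. K i -` {k} \<inter> space M"
  have meas: "K i \<in> M \<rightarrow>\<^sub>M count_space UNIV" if "i \<le> n" for i
    using ind that by (auto simp: indep_vars_def)
  then have E: "?E i k \<in> events" if "i \<le> n" for i k
    using that by (intro measurable_sets[of "K i"]) auto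
  have "\<exists>p. (\<forall>k. pmf p k = prob (?E i k)) \<and> set_pmf p \<subseteq> {..m}" if i: "i \<le> n" for i
  proof -
    have zero: "prob (?E i k) = 0" if "k > m" for k
    proof -
      have "K i \<omega> \<noteq> k" if "\<omega> \<in> space M" for \<omega>
        using K[OF i that] \<open>k > m\<close> by simp
      then have "?E i k = {}" by auto
      then show ?thesis by simp
    qed
    have one: "(\<Sum>k\<le>m. prob (?E i k)) = 1"
    proof -
      have "(\<Sum>k\<le>m. prob (?E i k)) = prob (\<Union>k\<in>{..m}. ?E i k)"
        using E[OF i] by (intro finite_measure_finite_Union[symmetric])
          (auto simp: disjoint_family_on_def)
      also have "(\<Union>k\<in>{..m}. ?E i k) = space M" using K[OF i] by auto
      finally show ?thesis by (simp add: prob_space)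
    qed
    obtain q where "\<And>k. pmf q k = prob (?E i k)" "set_pmf q \<subseteq> {..m}"
      using pmf_of_weights[OF measure_nonneg zero one] by blast
    then show ?thesis by blast
  qed
  then obtain p where p: "\<And>i k. i \<le> n \<Longrightarrow> pmf (p i) k = prob (?E i k)"
    "\<And>i. i \<le> n \<Longrightarrow> set_pmf (p i) \<subseteq> {..m}" by metis
  let ?A = "PiE_dflt {..n} 0 (\<lambda>_. {..m}) :: (nat \<Rightarrow> nat) set"
  have finA: "finite ?A" by (intro finite_PiE_dflt) auto
  let ?F = "\<lambda>y. \<Inter>i\<in>{..n}. ?E i (y i)"
  have F: "?F y \<in> events" for y using E by (intro sets.finite_INT) auto
  have PF: "prob (?F y) = (\<Prod>i\<le>n. pmf (p i) (y i))" for y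
    using indep_varsD[OF ind, of "{..n}" "\<lambda>i. {y i}"] by (simp add: p)
  have G: "G (\<lambda>i. if i \<le> n then K i \<omega> else 0) = (\<Sum>y\<in>?A. indicator (?F y) \<omega> * G y)"
    if \<omega>: "\<omega> \<in> space M" for G :: "(nat \<Rightarrow> nat) \<Rightarrow> real" and \<omega>
  proof -
    let ?y = "\<lambda>i. if i \<le> n then K i \<omega> else 0"
    have y: "?y \<in> ?A" using K \<omega> by (auto simp: PiE_dflt_def)
    have "indicator (?F y) \<omega> = (if y = ?y then 1 else 0 :: real)" if "y \<in> ?A" for y
    proof -
      have "\<omega> \<in> ?F y \<longleftrightarrow> (\<forall>i\<le>n. K i \<omega> = y i)" using \<omega> by auto
      also have "\<dots> \<longleftrightarrow> y = ?y" using that by (auto simp: PiE_dflt_def fun_eq_iff)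
      finally show ?thesis by (simp add: indicator_def)
    qed
    then have "(\<Sum>y\<in>?A. indicator (?F y) \<omega> * G y) = (\<Sum>y\<in>?A. if y = ?y then G y else 0)"
      by (intro sum.cong) auto
    then show ?thesis using finA y by simp
  qed
  have int: "integrable M (\<lambda>\<omega>. indicator (?F y) \<omega> * c)" for y and c :: real
    using F[of y] by (intro integrable_mult_left) (simp add: integrable_indicator_iff emeasure_eq_measure)
  show thesis
  proof (rule that[OF p(2)])
    show "integrable M (\<lambda>\<omega>. G (\<lambda>i. if i \<le> n then K i \<omega> else 0))" for G :: "(nat \<Rightarrow> nat) \<Rightarrow> real"
      by (subst Bochner_Integration.integrable_cong[OF refl G])
         (assumption, rule Bochner_Integration.integrable_sum, rule int)
    fix G :: "(nat \<Rightarrow> nat) \<Rightarrow> real"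
    have "expectation (\<lambda>\<omega>. G (\<lambda>i. if i \<le> n then K i \<omega> else 0))
       = expectation (\<lambda>\<omega>. \<Sum>y\<in>?A. indicator (?F y) \<omega> * G y)"
      by (rule Bochner_Integration.integral_cong[OF refl G])
    also have "\<dots> = (\<Sum>y\<in>?A. expectation (\<lambda>\<omega>. indicator (?F y) \<omega> * G y))"
      by (rule Bochner_Integration.integral_sum) (rule int)
    also have "\<dots> = (\<Sum>y\<in>?A. prob (?F y) * G y)"
    proof (rule sum.cong[OF refl])
      fix y
      have "expectation (indicator (?F y)) = prob (?F y)"
        using F[of y] by simp
      then show "expectation (\<lambda>\<omega>. indicator (?F y) \<omega> * G y) = prob (?F y) * G y"
        by simp
    qed
    also have "\<dots> = measure_pmf.expectation (Pi_pmf {..n} 0 p) G"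
      unfolding PF by (rule expectation_Pi_pmf_finite[symmetric]) (rule p(2))
    finally show "expectation (\<lambda>\<omega>. G (\<lambda>i. if i \<le> n then K i \<omega> else 0))
       = measure_pmf.expectation (Pi_pmf {..n} 0 p) G" .
  qed
qed

section \<open>Random measures with finitely many fixed atoms\<close>

lemma space_finite_measure_algebra: "space finite_measure_algebra = finite_measures"
  unfolding finite_measure_algebra_def by (rule space_measure_of) auto

text \<open>The measure \<open>a 0 \<delta>\<^sub>0 + ... + a n \<delta>\<^sub>n\<close> with \<open>\<delta>\<^sub>i\<close> the point mass at \<open>d i\<close>. Repeated points are
  allowed, their masses add up.\<close>

definition atomic :: "(nat \<Rightarrow> 'a::topological_space) \<Rightarrow> nat \<Rightarrow> (nat \<Rightarrow> real) \<Rightarrow> 'a measure" where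
  "atomic d n a = distr (point_measure {..n} (\<lambda>i. ennreal (a i))) borel d"

lemma measurable_point_measure_atMost [measurable]: "d \<in> point_measure {..n::nat} a \<rightarrow>\<^sub>M borel"
  by (simp add: point_measure_def)

lemma atomic_finite_measures: "atomic d n a \<in> finite_measures"
proof -
  have "emeasure (point_measure {..n} (\<lambda>i. ennreal (a i))) {..n} < \<infinity>"
    by (subst emeasure_point_measure_finite) auto
  then have "finite_measure (point_measure {..n} (\<lambda>i. ennreal (a i)))"
    by (intro finite_measureI) (auto simp: space_point_measure)
  then show ?thesis
    unfolding finite_measures_def atomic_def
    by (auto intro: finite_measure.finite_measure_distr)
qed

lemma integral_atomic:
  fixes f :: "'a::topological_space \<Rightarrow> real"
  assumes "f \<in> borel_measurable borel" "\<And>i. a i \<ge> 0"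
  shows "(\<integral>x. f x \<partial>atomic d n a) = (\<Sum>i\<le>n. a i * f (d i))"
  unfolding atomic_def using assms
  by (subst integral_distr) (auto simp: lebesgue_integral_point_measure_finite)

lemma measure_atomic:
  assumes "B \<in> sets borel" "\<And>i. a i \<ge> 0"
  shows "measure (atomic d n a) B = (\<Sum>i\<in>{i. i \<le> n \<and> d i \<in> B}. a i)"
proof -
  have "measure (atomic d n a) B = (\<integral>x. indicator B x \<partial>atomic d n a)"
    by (simp add: atomic_def)
  also have "\<dots> = (\<Sum>i\<le>n. a i * indicator B (d i))"
    using assms by (intro integral_atomic) auto
  also have "\<dots> = (\<Sum>i\<in>{i. i \<le> n \<and> d i \<in> B}. a i)"
    by (intro sum.mono_neutral_cong_right) (auto simp: indicator_def)
  finally show ?thesis .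
qed

text \<open>Independence is a property of the joint law, which \<open>map_pmf\<close> transports.\<close>

lemma indep_vars_map_pmf:
  assumes ind: "prob_space.indep_vars (measure_pmf p) M' (\<lambda>i. X i \<circ> F) I" and I: "I \<noteq> {}"
    and X: "\<And>i x. i \<in> I \<Longrightarrow> X i x \<in> space (M' i)"
  shows "prob_space.indep_vars (measure_pmf (map_pmf F p)) M' X I"
proof -
  have *: "distr (measure_pmf (map_pmf F p)) N f = distr (measure_pmf p) N (f \<circ> F)"
    if "\<And>x. f x \<in> space N" for N :: "'e measure" and f
    unfolding map_pmf_rep_eq using that by (subst distr_distr) auto
  have "distr (measure_pmf (map_pmf F p)) (Pi\<^sub>M I M') (\<lambda>x. \<lambda>i\<in>I. X i x)
      = distr (measure_pmf p) (Pi\<^sub>M I M') ((\<lambda>x. \<lambda>i\<in>I. X i x) \<circ> F)"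
    using X by (intro *) (auto simp: space_PiM)
  also have "(\<lambda>x. \<lambda>i\<in>I. X i x) \<circ> F = (\<lambda>x. \<lambda>i\<in>I. (X i \<circ> F) x)"
    by (simp add: comp_def)
  also have "distr (measure_pmf p) (Pi\<^sub>M I M') (\<lambda>x. \<lambda>i\<in>I. (X i \<circ> F) x)
      = (\<Pi>\<^sub>M i\<in>I. distr (measure_pmf p) (M' i) (X i \<circ> F))"
    using prob_space.indep_vars_iff_distr_eq_PiM'[OF measure_pmf.prob_space_axioms I,
        where M' = M' and X = "\<lambda>i. X i \<circ> F"] ind X by simp
  also have "\<dots> = (\<Pi>\<^sub>M i\<in>I. distr (measure_pmf (map_pmf F p)) (M' i) (X i))"
    using X by (intro PiM_cong refl) (simp add: *)
  finally have "distr (measure_pmf (map_pmf F p)) (Pi\<^sub>M I M') (\<lambda>x. \<lambda>i\<in>I. X i x)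
      = (\<Pi>\<^sub>M i\<in>I. distr (measure_pmf (map_pmf F p)) (M' i) (X i))" .
  then show ?thesis
    by (rule iffD2[OF prob_space.indep_vars_iff_distr_eq_PiM'[OF measure_pmf.prob_space_axioms I], rotated])
       (use X in simp)
qed

text \<open>A random measure must take its values in \<open>finite_measures\<close> on the whole probability space. When the
  space is the type of all measures, with a law carried by finite ones, the identity map has to be
  modified off that carrier.\<close>

definition coerce_finite :: "'a::topological_space measure \<Rightarrow> 'a measure" where
  "coerce_finite \<mu> = (if \<mu> \<in> finite_measures then \<mu> else null_measure borel)"

lemma coerce_finite_in: "coerce_finite (\<mu> :: 'a::topological_space measure) \<in> finite_measures"
proof -
  have "(null_measure borel :: 'a measure) \<in> finite_measures"
    by (auto simp: finite_measures_def intro!: finite_measureI)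
  then show ?thesis by (simp add: coerce_finite_def)
qed

lemma char_lattice_pmf:
  assumes "set_pmf q \<subseteq> {..m}"
  shows "char (distr (measure_pmf q) borel (\<lambda>k. h * real k)) \<theta> = poly (gen_poly m q) (cis (h * \<theta>))"
proof -
  have "char (distr (measure_pmf q) borel (\<lambda>k. h * real k)) \<theta>
      = measure_pmf.expectation q (\<lambda>k. iexp (\<theta> * (h * real k)))"
    unfolding char_def by (subst integral_distr) auto
  also have "\<dots> = (\<Sum>k\<le>m. pmf q k *\<^sub>R iexp (\<theta> * (h * real k)))"
    using assms by (intro integral_measure_pmf) auto
  also have "\<dots> = (\<Sum>k\<le>m. of_real (pmf q k) * cis (h * \<theta>) ^ k)"
  proof (rule sum.cong[OF refl])
    fix k
    have "cis (h * \<theta>) ^ k = iexp (\<theta> * (h * real k))"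
      by (simp only: Complex.DeMoivre) (simp add: cis_conv_exp mult_ac)
    then show "pmf q k *\<^sub>R iexp (\<theta> * (h * real k)) = of_real (pmf q k) * cis (h * \<theta>) ^ k"
      by (simp add: scaleR_conv_of_real)
  qed
  finally show ?thesis by (simp add: poly_gen_poly)
qed

lemma cnj_gen_poly: "cnj (poly (gen_poly m q) z) = poly (gen_poly m q) (cnj z)"
  by (simp add: poly_gen_poly)

text \<open>Masses of disjoint sets are sums over disjoint sets of independent coordinates. The characteristic
  function of the mass of one set is a product of zero-free generating polynomials and so is itself
  of the form treated in \<open>qid_poly\<close>.\<close>

lemma atomic_pmf_qid:
  fixes d :: "nat \<Rightarrow> 'a::topological_space"
  assumes q: "\<And>i. i \<le> n \<Longrightarrow> set_pmf (q i) \<subseteq> {..m}"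
    and nz: "\<And>i z. i \<le> n \<Longrightarrow> norm z = 1 \<Longrightarrow> poly (gen_poly m (q i)) z \<noteq> 0"
    and h: "h > 0"
  defines "N \<equiv> map_pmf (\<lambda>y. atomic d n (\<lambda>i. h * real (y i))) (Pi_pmf {..n} 0 q)"
  shows "bounded_random_measure (measure_pmf N) coerce_finite"
    and "qid_random_measure (measure_pmf N) coerce_finite"
proof -
  let ?P = "Pi_pmf {..n} 0 q"
  let ?F = "\<lambda>y. atomic d n (\<lambda>i. h * real (y i))"
  let ?J = "\<lambda>B. {i. i \<le> n \<and> d i \<in> B}"
  show "bounded_random_measure (measure_pmf N) coerce_finite"
    unfolding bounded_random_measure_def
    by (auto simp: measurable_pmf_measure1 space_finite_measure_algebra coerce_finite_in
        intro: measure_pmf.prob_space_axioms)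
  have F: "measure (coerce_finite (?F y)) B = (\<Sum>i\<in>?J B. h * real (y i))"
    if "B \<in> sets borel" for B y
    using that h by (simp add: coerce_finite_def atomic_finite_measures measure_atomic)
  have ind: "prob_space.indep_vars (measure_pmf ?P) (\<lambda>_. count_space UNIV) (\<lambda>i f. f i) {..n}"
    by (rule indep_vars_Pi_pmf) simp
  have "independently_scattered (measure_pmf N) coerce_finite"
    unfolding independently_scattered_def
  proof (intro allI impI)
    fix B :: "nat \<Rightarrow> 'a set" assume B: "range B \<subseteq> sets borel \<and> disjoint_family B"
    then have Bj: "B j \<in> sets borel" for j by auto
    have "prob_space.indep_vars (measure_pmf ?P) (\<lambda>j. PiM (?J (B j)) (\<lambda>_. count_space UNIV)) (\<lambda>j f. restrict f (?J (B j))) UNIV"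
      using prob_space.indep_vars_restrict[OF measure_pmf.prob_space_axioms ind, of UNIV "\<lambda>j. ?J (B j)"] B
      by (auto simp: disjoint_family_on_def)
    then have "prob_space.indep_vars (measure_pmf ?P) (\<lambda>_. borel) (\<lambda>j y. \<Sum>i\<in>?J (B j). h * real (restrict y (?J (B j)) i)) UNIV"
    proof (rule prob_space.indep_vars_compose2[OF measure_pmf.prob_space_axioms])
      fix j :: nat
      show "(\<lambda>f. \<Sum>i\<in>?J (B j). h * real (f i))
          \<in> PiM (?J (B j)) (\<lambda>_. count_space UNIV) \<rightarrow>\<^sub>M borel"
        by (intro borel_measurable_sum borel_measurable_times borel_measurable_const
            measurable_compose[OF measurable_component_singleton]) auto
    qed
    then have "prob_space.indep_vars (measure_pmf ?P) (\<lambda>_. borel) (\<lambda>j. (\<lambda>\<mu>. measure (coerce_finite \<mu>) (B j)) \<circ> ?F) UNIV"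
      using F[OF Bj] by (simp add: comp_def)
    then show "prob_space.indep_vars (measure_pmf N) (\<lambda>_. borel)
        (\<lambda>j \<mu>. measure (coerce_finite \<mu>) (B j)) UNIV"
      unfolding N_def by (rule indep_vars_map_pmf) auto
  qed
  moreover have "qid_random_variable (measure_pmf N) (\<lambda>\<mu>. measure (coerce_finite \<mu>) B)"
    if B: "B \<in> sets borel" for B
  proof -
    let ?p = "\<Prod>i\<in>?J B. gen_poly m (q i)"
    have chr: "char (distr (measure_pmf N) borel (\<lambda>\<mu>. measure (coerce_finite \<mu>) B)) \<theta>
       = poly ?p (cis (h * \<theta>))" for \<theta>
    proof -
      have "distr (measure_pmf N) borel (\<lambda>\<mu>. measure (coerce_finite \<mu>) B)
          = distr (measure_pmf ?P) borel (\<lambda>y. \<Sum>i\<in>?J B. h * real (y i))"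
        unfolding N_def map_pmf_rep_eq by (subst distr_distr) (auto simp: comp_def F[OF B])
      moreover have "prob_space.indep_vars (measure_pmf ?P) (\<lambda>_. borel) (\<lambda>i y. h * real (y i)) (?J B)"
        by (rule prob_space.indep_vars_compose2[OF measure_pmf.prob_space_axioms
            prob_space.indep_vars_subset[OF measure_pmf.prob_space_axioms ind]]) auto
      ultimately have "char (distr (measure_pmf N) borel (\<lambda>\<mu>. measure (coerce_finite \<mu>) B)) \<theta>
          = (\<Prod>i\<in>?J B. char (distr (measure_pmf ?P) borel (\<lambda>y. h * real (y i))) \<theta>)"
        by (simp add: prob_space.char_distr_sum[OF measure_pmf.prob_space_axioms])
      also have "\<dots> = (\<Prod>i\<in>?J B. poly (gen_poly m (q i)) (cis (h * \<theta>)))"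
      proof (rule prod.cong[OF refl])
        fix i assume i: "i \<in> ?J B"
        have "distr (measure_pmf ?P) borel (\<lambda>y. h * real (y i))
            = distr (measure_pmf (map_pmf (\<lambda>y. y i) ?P)) borel (\<lambda>k. h * real k)"
          unfolding map_pmf_rep_eq by (subst distr_distr) (auto simp: comp_def)
        also have "map_pmf (\<lambda>y. y i) ?P = q i"
          using i by (simp add: Pi_pmf_component)
        finally show "char (distr (measure_pmf ?P) borel (\<lambda>y. h * real (y i))) \<theta>
            = poly (gen_poly m (q i)) (cis (h * \<theta>))"
          using i q by (simp add: char_lattice_pmf)
      qed
      finally show ?thesis by (simp add: poly_prod)
    qed
    have "\<exists>\<gamma> a \<nu>. quasi_levy_type \<nu> \<and> (\<forall>\<theta>. poly ?p (cis (h * \<theta>)) = exp (qid_exponent \<gamma> a \<nu> \<theta>))"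
    proof (rule qid_poly[OF _ _ _ h])
      show "poly ?p z \<noteq> 0" if "norm z = 1" for z
        using nz that by (simp add: poly_prod)
      show "poly ?p 1 = 1"
        using q by (simp add: poly_prod poly_gen_poly_1)
      show "cnj (poly ?p z) = poly ?p (cnj z)" for z
        by (simp add: poly_prod cnj_gen_poly)
    qed
    then show ?thesis unfolding qid_random_variable_def chr by simp
  qed
  ultimately show "qid_random_measure (measure_pmf N) coerce_finite"
    by (simp add: qid_random_measure_def)
qed

section \<open>Limits in the vague and weak topologies\<close>

lemma topspace_integral_topology: "topspace (integral_topology F) = finite_measures"
  unfolding integral_topology_def by auto

text \<open>In a topology with a given subbasis it is enough to test convergence on the subbasis, that is, on the
  integrals of the members of \<open>F\<close>.\<close>

lemma limitin_integral_topology: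
  assumes X: "\<And>n. X n \<in> finite_measures" and \<mu>: "\<mu> \<in> finite_measures"
    and lim: "\<And>f. f \<in> F \<Longrightarrow> (\<lambda>n. \<integral>x. f x \<partial>X n) \<longlonglongrightarrow> (\<integral>x. f x \<partial>\<mu>)"
  shows "limitin (integral_topology F) X \<mu> sequentially"
  unfolding limitin_def
proof (intro conjI allI impI)
  show "\<mu> \<in> topspace (integral_topology F)" by (simp add: topspace_integral_topology \<mu>)
  fix U assume "openin (integral_topology F) U \<and> \<mu> \<in> U"
  then have "generate_topology_on (insert finite_measures
       {{\<mu> \<in> finite_measures. (\<integral>x. f x \<partial>\<mu>) \<in> U} | f U. f \<in> F \<and> open U}) U" "\<mu> \<in> U"
    by (auto simp: integral_topology_def openin_topology_generated_by_iff)
  then show "eventually (\<lambda>n. X n \<in> U) sequentially"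
  proof (induction U rule: generate_topology_on.induct)
    case (Int a b)
    then show ?case by (auto intro: eventually_conj)
  next
    case (UN K)
    then obtain k where "k \<in> K" "\<mu> \<in> k" by auto
    then have "eventually (\<lambda>n. X n \<in> k) sequentially" using UN.IH by simp
    then show ?case by (rule eventually_mono) (use \<open>k \<in> K\<close> in auto)
  next
    case (Basis s)
    then consider "s = finite_measures"
      | f V where "f \<in> F" "open V" "s = {\<mu> \<in> finite_measures. (\<integral>x. f x \<partial>\<mu>) \<in> V}" by auto
    then show ?case
    proof cases
      case 1
      then show ?thesis by (simp add: X)
    next
      case 2
      then show ?thesis
        using topological_tendstoD[OF lim[OF 2(1)] 2(2)] Basis by (simp add: X)
    qed
  qed simp
qed

section \<open>Discretisation of a finite measure\<close>

text \<open>The least index of a point of \<open>d 0, ..., d n\<close> nearest to \<open>x\<close>. The recursion makes measurability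
  immediate.\<close>

primrec nearest :: "(nat \<Rightarrow> 'a::metric_space) \<Rightarrow> 'a \<Rightarrow> nat \<Rightarrow> nat" where
  "nearest d x 0 = 0"
| "nearest d x (Suc n) = (if dist x (d (Suc n)) < dist x (d (nearest d x n)) then Suc n else nearest d x n)"

lemma nearest_le: "nearest d x n \<le> n"
  by (induction n) auto

lemma dist_nearest_le: "j \<le> n \<Longrightarrow> dist x (d (nearest d x n)) \<le> dist x (d j)"
proof (induction n)
  case (Suc n)
  then show ?case by (cases "j = Suc n") (auto simp: le_Suc_eq)
qed simp

lemma measurable_nearest [measurable]:
  fixes d :: "nat \<Rightarrow> 'a::{metric_space, second_countable_topology}"
  shows "(\<lambda>x. nearest d x n) \<in> borel \<rightarrow>\<^sub>M count_space UNIV"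
proof (induction n)
  case (Suc n)
  have [measurable]: "(\<lambda>x. d (nearest d x n)) \<in> borel \<rightarrow>\<^sub>M borel"
    by (rule measurable_compose[OF Suc]) simp
  note [measurable] = Suc
  show ?case unfolding nearest.simps by measurable
qed simp

lemma nearest_tendsto:
  assumes dense: "\<And>U. open U \<Longrightarrow> U \<noteq> {} \<Longrightarrow> \<exists>j. d j \<in> U"
  shows "(\<lambda>n. d (nearest d x n)) \<longlonglongrightarrow> x"
proof (rule metric_LIMSEQ_I)
  fix r :: real assume r: "r > 0"
  then obtain j where j: "d j \<in> ball x r" using dense[of "ball x r"] by auto
  show "\<exists>no. \<forall>n\<ge>no. dist (d (nearest d x n)) x < r"
  proof (intro exI[of _ j] allI impI)
    fix n assume "n \<ge> j"
    from dist_nearest_le[OF this, of x d] j show "dist (d (nearest d x n)) x < r"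
      by (simp add: dist_commute)
  qed
qed

definition cell :: "(nat \<Rightarrow> 'a::metric_space) \<Rightarrow> nat \<Rightarrow> nat \<Rightarrow> 'a set" where
  "cell d n i = {x. nearest d x n = i}"

lemma cell_measurable:
  fixes d :: "nat \<Rightarrow> 'a::{metric_space, second_countable_topology}"
  shows "cell d n i \<in> sets borel"
proof -
  have "(\<lambda>x. nearest d x n) -` {i} \<inter> space borel \<in> sets borel"
    by (rule measurable_sets[OF measurable_nearest]) simp
  then show ?thesis by (simp add: cell_def vimage_def)
qed

lemma disjoint_cell: "disjoint_family (cell d n)"
  by (auto simp: disjoint_family_on_def cell_def)

text \<open>The mass \<open>x\<close> in units of the mesh \<open>1/(n+1)^2\<close>, cut off at \<open>(n+1)^3\<close> units, which is the mass \<open>n+1\<close>.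
  With \<open>n+1\<close> cells the rounding errors add up to at most \<open>1/(n+1)\<close>, while the cut-off tends to
  infinity.\<close>

definition lattice_count :: "nat \<Rightarrow> real \<Rightarrow> nat" where
  "lattice_count n x = min ((n + 1) ^ 3) (nat \<lfloor>x * (real n + 1)\<^sup>2\<rfloor>)"

definition mesh :: "nat \<Rightarrow> real" where
  "mesh n = 1 / (real n + 1)\<^sup>2"

lemma mesh_pos: "mesh n > 0"
  by (simp add: mesh_def add_nonneg_pos)

lemma lattice_count_error:
  assumes "0 \<le> x" "x \<le> real n"
  shows "\<bar>mesh n * real (lattice_count n x) - x\<bar> \<le> mesh n"
proof -
  let ?N = "(real n + 1)\<^sup>2"
  have N: "?N > 0" by (simp add: add_nonneg_pos)
  have "x * ?N \<le> (real n + 1) * ?N" using assms by (intro mult_right_mono) auto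
  also have "\<dots> = (real n + 1) ^ 3" by (simp add: power2_eq_square power3_eq_cube mult.assoc)
  also have "\<dots> = real ((n + 1) ^ 3)" by (simp add: add.commute)
  finally have "nat \<lfloor>x * ?N\<rfloor> \<le> (n + 1) ^ 3"
    by (metis floor_mono floor_of_nat nat_int nat_mono)
  then have "lattice_count n x = nat \<lfloor>x * ?N\<rfloor>" by (simp add: lattice_count_def)
  moreover have "\<lfloor>x * ?N\<rfloor> \<ge> 0" using assms by simp
  ultimately have "real (lattice_count n x) = of_int \<lfloor>x * ?N\<rfloor>" by simp
  then have "\<bar>real (lattice_count n x) - x * ?N\<bar> \<le> 1" by linarith
  then have "\<bar>real (lattice_count n x) - x * ?N\<bar> / ?N \<le> 1 / ?N" using N by (intro divide_right_mono) auto
  moreover have "\<bar>mesh n * real (lattice_count n x) - x\<bar> = \<bar>real (lattice_count n x) - x * ?N\<bar> / ?N"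
  proof -
    have "mesh n * real (lattice_count n x) - x = (real (lattice_count n x) - x * ?N) / ?N"
      using N by (simp add: mesh_def diff_divide_distrib)
    then show ?thesis using N by (simp add: abs_divide)
  qed
  ultimately show ?thesis by (simp add: mesh_def)
qed

text \<open>Moving the mass of each cell to its centre replaces \<open>f x\<close> by \<open>f\<close> at the nearest of
  \<open>d 0, ..., d n\<close>, which tends to \<open>f x\<close> for every \<open>x\<close>; dominated convergence applies as \<open>\<mu>\<close> is finite.
  Once \<open>n\<close> exceeds the total mass of \<open>\<mu>\<close>, the cut-off is void and rounding costs at most \<open>1/(n+1)\<close>
  in total mass.\<close>

lemma discretisation_converges:
  fixes d :: "nat \<Rightarrow> 'a::{metric_space, second_countable_topology}" and f :: "'a \<Rightarrow> real"
  assumes dense: "\<And>U. open U \<Longrightarrow> U \<noteq> {} \<Longrightarrow> \<exists>j. d j \<in> U"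
    and \<mu>: "\<mu> \<in> finite_measures"
    and f: "continuous_on UNIV f" "bounded (range f)"
  shows "(\<lambda>n. \<integral>x. f x \<partial>atomic d n (\<lambda>i. mesh n * real (lattice_count n (measure \<mu> (cell d n i)))))
    \<longlonglongrightarrow> (\<integral>x. f x \<partial>\<mu>)"
proof -
  have s: "sets \<mu> = sets borel" using \<mu> by (simp add: finite_measures_def)
  have sp: "space \<mu> = UNIV" using sets_eq_imp_space_eq[OF s] by simp
  interpret finite_measure \<mu> using \<mu> by (simp add: finite_measures_def)
  have fm: "f \<in> borel_measurable borel" using f(1) by (rule borel_measurable_continuous_onI)
  obtain C where C: "\<And>x. \<bar>f x\<bar> \<le> C" using f(2) by (auto simp: bounded_iff)
  let ?X = "\<lambda>n i. measure \<mu> (cell d n i)"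
  have fd: "f (d (nearest d x n)) = (\<Sum>i\<le>n. f (d i) * indicator (cell d n i) x)" for n x
  proof -
    have "(\<Sum>i\<le>n. f (d i) * indicator (cell d n i) x)
        = (\<Sum>i\<le>n. if i = nearest d x n then f (d i) else 0)"
      by (intro sum.cong) (auto simp: cell_def indicator_def)
    then show ?thesis using nearest_le[of d x n] by simp
  qed
  have meas: "(\<lambda>x. f (d (nearest d x n))) \<in> borel_measurable \<mu>" for n
    unfolding measurable_cong_sets[OF s refl]
    by (rule measurable_compose[OF measurable_nearest]) simp
  have "(\<lambda>n. \<integral>x. f (d (nearest d x n)) \<partial>\<mu>) \<longlonglongrightarrow> (\<integral>x. f x \<partial>\<mu>)"
  proof (rule integral_dominated_convergence[where w = "\<lambda>_. C"])
    show "f \<in> borel_measurable \<mu>" using fm by (simp add: measurable_cong_sets[OF s refl])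
    show "AE x in \<mu>. (\<lambda>n. f (d (nearest d x n))) \<longlonglongrightarrow> f x"
    proof (rule AE_I2)
      fix x
      have "isCont f x" using f(1) by (simp add: continuous_on_eq_continuous_at)
      then show "(\<lambda>n. f (d (nearest d x n))) \<longlonglongrightarrow> f x"
        using nearest_tendsto[OF dense] by (rule isCont_tendsto_compose)
    qed
  qed (use C meas in auto)
  moreover have "(\<integral>x. f (d (nearest d x n)) \<partial>\<mu>) = (\<Sum>i\<le>n. f (d i) * ?X n i)" for n
  proof -
    have c: "cell d n i \<in> sets \<mu>" for i using cell_measurable s by blast
    have "(\<integral>x. f (d (nearest d x n)) \<partial>\<mu>)
        = (\<Sum>i\<le>n. \<integral>x. f (d i) * indicator (cell d n i) x \<partial>\<mu>)"
      unfolding fd using c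
      by (intro Bochner_Integration.integral_sum integrable_mult_right)
         (simp add: integrable_indicator_iff less_top[symmetric] sp)
    also have "\<dots> = (\<Sum>i\<le>n. f (d i) * ?X n i)"
      by (intro sum.cong refl) (simp add: sp)
    finally show ?thesis .
  qed
  ultimately have lim: "(\<lambda>n. \<Sum>i\<le>n. f (d i) * ?X n i) \<longlonglongrightarrow> (\<integral>x. f x \<partial>\<mu>)" by simp
  let ?I = "\<lambda>n. \<integral>x. f x \<partial>atomic d n (\<lambda>i. mesh n * real (lattice_count n (?X n i)))"
  have I: "?I n = (\<Sum>i\<le>n. mesh n * real (lattice_count n (?X n i)) * f (d i))" for n
    using fm by (rule integral_atomic) (simp add: mesh_def)
  have "(\<lambda>n. ?I n - (\<Sum>i\<le>n. f (d i) * ?X n i)) \<longlonglongrightarrow> 0"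
  proof (rule Lim_null_comparison)
    show "(\<lambda>n. C / real (Suc n)) \<longlonglongrightarrow> 0" by (rule LIMSEQ_Suc) (rule lim_const_over_n)
    obtain n0 where n0: "measure \<mu> (space \<mu>) \<le> real n0" using real_arch_simple by blast
    show "eventually (\<lambda>n. norm (?I n - (\<Sum>i\<le>n. f (d i) * ?X n i)) \<le> C / real (Suc n)) sequentially"
    proof (rule eventually_sequentiallyI)
      fix n assume n: "n0 \<le> n"
      have X: "?X n i \<le> real n" for i
        using bounded_measure[of "cell d n i"] n0 n by linarith
      have "norm (?I n - (\<Sum>i\<le>n. f (d i) * ?X n i))
          = \<bar>\<Sum>i\<le>n. (mesh n * real (lattice_count n (?X n i)) - ?X n i) * f (d i)\<bar>"
        by (simp add: I sum_subtractf left_diff_distrib right_diff_distrib mult.commute)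
      also have "\<dots> \<le> (\<Sum>i\<le>n. mesh n * C)"
      proof (rule order.trans[OF sum_abs sum_mono])
        fix i
        show "\<bar>(mesh n * real (lattice_count n (?X n i)) - ?X n i) * f (d i)\<bar> \<le> mesh n * C"
          unfolding abs_mult using C[of "d i"] lattice_count_error[OF measure_nonneg X[of i]] mesh_pos[of n]
          by (intro mult_mono) auto
      qed
      also have "\<dots> = C / real (Suc n)"
      proof -
        have "y * (1 / y\<^sup>2 * C) = C / y" if "y > 0" for y :: real
          using that by (simp add: power2_eq_square)
        from this[of "real (Suc n)"] show ?thesis by (simp add: mesh_def add.commute)
      qed
      finally show "norm (?I n - (\<Sum>i\<le>n. f (d i) * ?X n i)) \<le> C / real (Suc n)" .
    qed
  qed
  from tendsto_add[OF this lim] show ?thesis by simp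
qed

lemma lattice_count_measurable [measurable]: "lattice_count n \<in> borel \<rightarrow>\<^sub>M count_space UNIV"
proof -
  have "(\<lambda>k. min ((n + 1) ^ 3) (nat k)) \<in> count_space UNIV \<rightarrow>\<^sub>M count_space UNIV" by simp
  moreover have "(\<lambda>x. \<lfloor>x * (real n + 1)\<^sup>2\<rfloor>) \<in> borel \<rightarrow>\<^sub>M count_space UNIV" by measurable
  ultimately show ?thesis unfolding lattice_count_def[abs_def] by (rule measurable_compose[rotated])
qed

section \<open>Density of the QID random measures\<close>

text \<open>On the probability space of \<open>\<xi>\<close> the discretised measures \<open>G n (K n)\<close> converge to \<open>\<xi>\<close> at every
  \<open>\<omega>\<close>. Their expectations are finite sums over the product of the laws \<open>p n i\<close>, which are compared
  with the same sums over the zero-free laws \<open>q n i\<close>.\<close>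

proposition qid_approximation:
  fixes M :: "'w measure" and \<xi> :: "'w \<Rightarrow> 'a::polish_space measure"
  assumes \<xi>: "bounded_random_measure M \<xi>" and scattered: "independently_scattered M \<xi>"
    and F: "\<And>f. f \<in> F \<Longrightarrow> continuous_on UNIV f \<and> bounded (range f)"
  shows "\<exists>(N :: nat \<Rightarrow> 'a measure measure) (\<eta> :: nat \<Rightarrow> 'a measure \<Rightarrow> 'a measure).
      (\<forall>n. bounded_random_measure (N n) (\<eta> n) \<and> qid_random_measure (N n) (\<eta> n)) \<and>
      converges_in_distribution (integral_topology F) N \<eta> M \<xi>"
proof -
  interpret prob_space M using \<xi> by (simp add: bounded_random_measure_def)
  have \<xi>m: "\<xi> \<in> M \<rightarrow>\<^sub>M finite_measure_algebra" using \<xi> by (simp add: bounded_random_measure_def)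
  have \<xi>fin: "\<xi> \<omega> \<in> finite_measures" if "\<omega> \<in> space M" for \<omega>
    using measurable_space[OF \<xi>m that] by (simp add: space_finite_measure_algebra)
  obtain D :: "'a set" where D: "countable D" "\<And>U. open U \<Longrightarrow> U \<noteq> {} \<Longrightarrow> \<exists>d\<in>D. d \<in> U"
    by (rule countable_dense_setE) (rule that; assumption)
  define d where "d = from_nat_into D"
  have "D \<noteq> {}" using D(2)[of UNIV] by auto
  then have dense: "\<exists>j. d j \<in> U" if "open U" "U \<noteq> {}" for U
    using D(2)[OF that] from_nat_into_surj[OF D(1)] unfolding d_def by metis
  define K where "K n i \<omega> = lattice_count n (measure (\<xi> \<omega>) (cell d n i))" for n i \<omega>
  define G where "G n y = atomic d n (\<lambda>i. mesh n * real (y i))" for n and y :: "nat \<Rightarrow> nat"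
  define Q where "Q n p \<longleftrightarrow> (\<forall>i\<le>n. set_pmf (p i) \<subseteq> {..(n + 1) ^ 3}) \<and>
      (\<forall>g :: 'a measure \<Rightarrow> real. integrable M (\<lambda>\<omega>. g (G n (\<lambda>i. if i \<le> n then K n i \<omega> else 0))) \<and>
         expectation (\<lambda>\<omega>. g (G n (\<lambda>i. if i \<le> n then K n i \<omega> else 0)))
           = measure_pmf.expectation (Pi_pmf {..n} 0 p) (\<lambda>y. g (G n y)))" for n p
  have "\<exists>p. Q n p" for n
  proof -
    have "indep_vars (\<lambda>_. borel) (\<lambda>i \<omega>. measure (\<xi> \<omega>) (cell d n i)) UNIV"
      using scattered[unfolded independently_scattered_def, rule_format, of "cell d n"]
        disjoint_cell[of d n] cell_measurable[of d n] by auto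
    then have "indep_vars (\<lambda>_. borel) (\<lambda>i \<omega>. measure (\<xi> \<omega>) (cell d n i)) {..n}"
      by (rule indep_vars_subset) simp
    then have ind: "indep_vars (\<lambda>_. count_space UNIV) (K n) {..n}"
      unfolding K_def[abs_def]
      by (rule indep_vars_compose2[where Y = "\<lambda>_. lattice_count n"]) (rule lattice_count_measurable)
    show ?thesis
    proof (rule expectation_indep_nat[OF ind])
      show "K n i \<omega> \<le> (n + 1) ^ 3" for i \<omega> by (simp add: K_def lattice_count_def)
      fix p :: "nat \<Rightarrow> nat pmf"
      assume p: "\<And>i. i \<le> n \<Longrightarrow> set_pmf (p i) \<subseteq> {..(n + 1) ^ 3}"
        "\<And>G :: (nat \<Rightarrow> nat) \<Rightarrow> real. integrable M (\<lambda>\<omega>. G (\<lambda>i. if i \<le> n then K n i \<omega> else 0))"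
        "\<And>G :: (nat \<Rightarrow> nat) \<Rightarrow> real. expectation (\<lambda>\<omega>. G (\<lambda>i. if i \<le> n then K n i \<omega> else 0))
           = measure_pmf.expectation (Pi_pmf {..n} 0 p) G"
      show "\<exists>p. Q n p"
        unfolding Q_def
      proof (intro exI[of _ p] conjI allI impI)
        show "set_pmf (p i) \<subseteq> {..(n + 1) ^ 3}" if "i \<le> n" for i using that by (rule p(1))
        fix g :: "'a measure \<Rightarrow> real"
        show "integrable M (\<lambda>\<omega>. g (G n (\<lambda>i. if i \<le> n then K n i \<omega> else 0)))"
          by (rule p(2)[of "\<lambda>y. g (G n y)"])
        show "expectation (\<lambda>\<omega>. g (G n (\<lambda>i. if i \<le> n then K n i \<omega> else 0)))
           = measure_pmf.expectation (Pi_pmf {..n} 0 p) (\<lambda>y. g (G n y))"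
          by (rule p(3)[of "\<lambda>y. g (G n y)"])
      qed
    qed
  qed
  then obtain p where "\<And>n. Q n (p n)" by metis
  then have p: "\<And>n i. i \<le> n \<Longrightarrow> set_pmf (p n i) \<subseteq> {..(n + 1) ^ 3}"
    and pint: "\<And>n (g :: 'a measure \<Rightarrow> real). integrable M (\<lambda>\<omega>. g (G n (\<lambda>i. if i \<le> n then K n i \<omega> else 0)))"
    and pexp: "\<And>n (g :: 'a measure \<Rightarrow> real). expectation (\<lambda>\<omega>. g (G n (\<lambda>i. if i \<le> n then K n i \<omega> else 0)))
           = measure_pmf.expectation (Pi_pmf {..n} 0 (p n)) (\<lambda>y. g (G n y))"
    unfolding Q_def by simp_all
  \<comment> \<open>chosen such that the bound of \<open>expectation_Pi_pmf_diff\<close> becomes \<open>C / (n + 1)\<close>\<close>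
  define \<epsilon> where "\<epsilon> n = 1 / (real (((n + 1) ^ 3 + 1) ^ (n + 1)) * (real (n + 1))\<^sup>2)" for n
  have \<epsilon>: "\<epsilon> n > 0" for n
    unfolding \<epsilon>_def
    by (intro divide_pos_pos mult_pos_pos zero_less_power of_nat_0_less_iff[THEN iffD2]) auto
  define R where "R n i q \<longleftrightarrow> set_pmf q \<subseteq> {..(n + 1) ^ 3} \<and> (\<forall>k. \<bar>pmf q k - pmf (p n i) k\<bar> \<le> \<epsilon> n) \<and>
      (\<forall>z. norm z = 1 \<longrightarrow> poly (gen_poly ((n + 1) ^ 3) q) z \<noteq> 0)" for n i q
  have ex: "\<exists>q. R n i q" if "i \<le> n" for n i
    by (rule zero_free_approximation[OF p[OF that] \<epsilon>[of n]]) (auto simp: R_def)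
  define q where "q n i = (SOME q. R n i q)" for n i
  have R: "R n i (q n i)" if "i \<le> n" for n i
    unfolding q_def by (rule someI_ex) (rule ex[OF that])
  have q: "set_pmf (q n i) \<subseteq> {..(n + 1) ^ 3}"
    and pq: "\<bar>pmf (q n i) k - pmf (p n i) k\<bar> \<le> \<epsilon> n" if "i \<le> n" for n i k
    using R[OF that] unfolding R_def by simp_all
  have nz: "poly (gen_poly ((n + 1) ^ 3) (q n i)) z \<noteq> 0" if "i \<le> n" "norm z = 1" for n i z
    using R[OF that(1)] that(2) unfolding R_def by simp
  define N where "N n = map_pmf (G n) (Pi_pmf {..n} 0 (q n))" for n
  have qid: "bounded_random_measure (measure_pmf (N n)) coerce_finite"
    "qid_random_measure (measure_pmf (N n)) coerce_finite" for n
    unfolding N_def G_def[abs_def]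
    by ((rule atomic_pmf_qid; (rule q nz mesh_pos; assumption)?)+)
  have "converges_in_distribution (integral_topology F) (\<lambda>n. measure_pmf (N n)) (\<lambda>_. coerce_finite) M \<xi>"
    unfolding converges_in_distribution_def topspace_integral_topology
  proof (intro allI impI)
    fix g :: "'a measure \<Rightarrow> real"
    assume "continuous_map (integral_topology F) euclideanreal g \<and> bounded (g ` finite_measures)"
    then have cont: "continuous_map (integral_topology F) euclideanreal g"
      and "bounded (g ` finite_measures)" by auto
    then obtain C where C: "\<And>\<mu>. \<mu> \<in> finite_measures \<Longrightarrow> \<bar>g \<mu>\<bar> \<le> C"
      by (auto simp: bounded_iff)
    have GC: "\<bar>g (G n y)\<bar> \<le> C" for n y
      unfolding G_def by (intro C atomic_finite_measures)
    let ?Y = "\<lambda>n \<omega>. G n (\<lambda>i. if i \<le> n then K n i \<omega> else 0)"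
    have lim: "(\<lambda>n. g (?Y n \<omega>)) \<longlonglongrightarrow> g (\<xi> \<omega>)" if \<omega>: "\<omega> \<in> space M" for \<omega>
    proof -
      have "limitin (integral_topology F) (\<lambda>n. ?Y n \<omega>) (\<xi> \<omega>) sequentially"
      proof (rule limitin_integral_topology)
        show "?Y n \<omega> \<in> finite_measures" for n unfolding G_def by (rule atomic_finite_measures)
        show "\<xi> \<omega> \<in> finite_measures" by (rule \<xi>fin[OF \<omega>])
        fix f assume f: "f \<in> F"
        then have fm: "f \<in> borel_measurable borel"
          using F by (intro borel_measurable_continuous_onI) auto
        have "(\<integral>x. f x \<partial>?Y n \<omega>)
            = (\<integral>x. f x \<partial>atomic d n (\<lambda>i. mesh n * real (lattice_count n (measure (\<xi> \<omega>) (cell d n i)))))" for n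
          unfolding G_def K_def using fm mesh_pos[of n] by (simp add: integral_atomic)
        then show "(\<lambda>n. \<integral>x. f x \<partial>?Y n \<omega>) \<longlonglongrightarrow> (\<integral>x. f x \<partial>\<xi> \<omega>)"
          using discretisation_converges[OF dense \<xi>fin[OF \<omega>]] F[OF f] by simp
      qed
      from continuous_map_limit[OF cont this] show ?thesis by (simp add: comp_def)
    qed
    \<comment> \<open>the limit of the finitely valued, hence measurable, variables \<open>g (?Y n \<omega>)\<close>\<close>
    have gm: "(\<lambda>\<omega>. g (\<xi> \<omega>)) \<in> borel_measurable M"
    proof (rule borel_measurable_LIMSEQ_real)
      show "(\<lambda>n. g (?Y n \<omega>)) \<longlonglongrightarrow> g (\<xi> \<omega>)" if "\<omega> \<in> space M" for \<omega> using that by (rule lim)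
      show "(\<lambda>\<omega>. g (?Y n \<omega>)) \<in> borel_measurable M" for n
        by (rule borel_measurable_integrable[OF pint])
    qed
    have int: "integrable M (\<lambda>\<omega>. g (\<xi> \<omega>))"
    proof (rule integrable_const_bound[OF _ gm])
      show "AE \<omega> in M. norm (g (\<xi> \<omega>)) \<le> C"
        unfolding real_norm_def by (rule AE_I2) (rule C[OF \<xi>fin])
    qed
    have conv: "(\<lambda>n. expectation (\<lambda>\<omega>. g (?Y n \<omega>))) \<longlonglongrightarrow> expectation (\<lambda>\<omega>. g (\<xi> \<omega>))"
    proof (rule integral_dominated_convergence[OF gm])
      show "(\<lambda>\<omega>. g (?Y n \<omega>)) \<in> borel_measurable M" for n
        by (rule borel_measurable_integrable[OF pint])
      show "integrable M (\<lambda>_. C)" by simp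
      show "AE \<omega> in M. (\<lambda>n. g (?Y n \<omega>)) \<longlonglongrightarrow> g (\<xi> \<omega>)" by (rule AE_I2) (rule lim)
      show "AE \<omega> in M. norm (g (?Y n \<omega>)) \<le> C" for n
        unfolding real_norm_def by (rule AE_I2) (rule GC)
    qed
    have EN: "(\<integral>\<mu>. g (coerce_finite \<mu>) \<partial>N n) = measure_pmf.expectation (Pi_pmf {..n} 0 (q n)) (\<lambda>y. g (G n y))" for n
      by (simp add: N_def G_def coerce_finite_def atomic_finite_measures)
    have "(\<lambda>n. (\<integral>\<mu>. g (coerce_finite \<mu>) \<partial>N n) - expectation (\<lambda>\<omega>. g (?Y n \<omega>))) \<longlonglongrightarrow> 0"
    proof (rule Lim_null_comparison)
      show "(\<lambda>n. C / real (Suc n)) \<longlonglongrightarrow> 0" by (rule LIMSEQ_Suc) (rule lim_const_over_n)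
      have "norm ((\<integral>\<mu>. g (coerce_finite \<mu>) \<partial>N n) - expectation (\<lambda>\<omega>. g (?Y n \<omega>)))
          \<le> C / real (Suc n)" for n
      proof -
        have "norm ((\<integral>\<mu>. g (coerce_finite \<mu>) \<partial>N n) - expectation (\<lambda>\<omega>. g (?Y n \<omega>)))
            \<le> real (((n + 1) ^ 3 + 1) ^ (n + 1)) * (real (n + 1) * \<epsilon> n) * C"
          unfolding EN pexp real_norm_def
          by (rule expectation_Pi_pmf_diff; (rule p q pq GC; assumption))
        also have "\<dots> = C / real (Suc n)"
        proof -
          have *: "x * (y * (1 / (x * y\<^sup>2))) * C = C / y" if "x > 0" "y > 0" for x y :: real
            using that by (simp add: power2_eq_square)
          have "real (((n + 1) ^ 3 + 1) ^ (n + 1)) > 0"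
            by (intro of_nat_0_less_iff[THEN iffD2] zero_less_power) auto
          moreover have "real (n + 1) > 0" by simp
          ultimately show ?thesis unfolding \<epsilon>_def Suc_eq_plus1 by (rule *)
        qed
        finally show ?thesis .
      qed
      then show "eventually (\<lambda>n. norm ((\<integral>\<mu>. g (coerce_finite \<mu>) \<partial>N n)
          - expectation (\<lambda>\<omega>. g (?Y n \<omega>))) \<le> C / real (Suc n)) sequentially" by simp
    qed
    from tendsto_add[OF this conv]
    have "(\<lambda>n. \<integral>\<mu>. g (coerce_finite \<mu>) \<partial>N n) \<longlonglongrightarrow> expectation (\<lambda>\<omega>. g (\<xi> \<omega>))" by simp
    moreover have "integrable (measure_pmf (N n)) (\<lambda>\<mu>. g (coerce_finite \<mu>))" for n
      using C[OF coerce_finite_in] by (intro measure_pmf.integrable_const_bound[where B = C]) auto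
    ultimately show "(\<forall>n. integrable (measure_pmf (N n)) (\<lambda>\<mu>. g (coerce_finite \<mu>))) \<and>
        integrable M (\<lambda>\<omega>. g (\<xi> \<omega>)) \<and>
        (\<lambda>n. \<integral>\<mu>. g (coerce_finite \<mu>) \<partial>N n) \<longlonglongrightarrow> (\<integral>\<omega>. g (\<xi> \<omega>) \<partial>M)"
      using int by blast
  qed
  with qid show ?thesis
    by (intro exI[of _ "\<lambda>n. measure_pmf (N n)"] exI[of _ "\<lambda>_. coerce_finite"] conjI allI)
qed

theorem theorem8p7:
  fixes M :: "'w measure" and \<xi> :: "'w \<Rightarrow> 'a::polish_space measure"
  assumes "bounded_random_measure M \<xi>"
    and "independently_scattered M \<xi>"
  shows "\<forall>T \<in> {vague_topology, weak_topology}.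
    \<exists>(N :: nat \<Rightarrow> 'a measure measure) (\<eta> :: nat \<Rightarrow> 'a measure \<Rightarrow> 'a measure).
      (\<forall>n. bounded_random_measure (N n) (\<eta> n) \<and> qid_random_measure (N n) (\<eta> n)) \<and>
      converges_in_distribution T N \<eta> M \<xi>"
proof
  fix T :: "'a measure topology" assume "T \<in> {vague_topology, weak_topology}"
  then obtain F where "T = integral_topology F"
    and "\<And>f. f \<in> F \<Longrightarrow> continuous_on UNIV f \<and> bounded (range f)"
    unfolding vague_topology_def weak_topology_def by blast
  then show "\<exists>(N :: nat \<Rightarrow> 'a measure measure) (\<eta> :: nat \<Rightarrow> 'a measure \<Rightarrow> 'a measure).
      (\<forall>n. bounded_random_measure (N n) (\<eta> n) \<and> qid_random_measure (N n) (\<eta> n)) \<and>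
      converges_in_distribution T N \<eta> M \<xi>"
    using qid_approximation[OF assms] by blast
qed

end
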